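(* Let $G$ be a topological group. The following conditions are equivalent: (1) $G$ is uniformly Lindelöf. (2) The greatest ambit $G^R$ is m-approximable. (3) Every compact $G$-system is m-approximable. (4) For every (not necessarily compact) $G$-space $X$ and each $f\in RUC(X)$ the $G$-system $X_f$ is metrizable.
   Context: All spaces are Hausdorff and completely regular. A $G$-space is a topological space $X$ with a (jointly) continuous left action of $G$; a compact $G$-space is called a compact $G$-system. $G$ is uniformly Lindelöf if for every neighborhood $U$ of the identity there is a countable $C\subset G$ with $G=CU$. A compact $G$-system is m-approximable if it is isomorphic to a $G$-subsystem of a product of metrizable compact $G$-systems. For a $G$-space $X$, $RUC(X)$ is the algebra of bounded continuous $f:X\to\mathbb R$ for which the orbit map $G\to C(X)$, $g\mapsto{}_gf$, ${}_gf(x)=f(gx)$, is continuous into the sup norm. $RUC(G)$ is this algebra for $X=G$ with left translations. The greatest ambit $G^R$ is the Gelfand space (space of multiplicative linear functionals with the weak$^*$ topology) of $RUC(G)$, with the action $(g\varphi)(f)=\varphi({}_gf)$. For $f\in RUC(X)$, put $f_\sharp:X\to[-\|f\|,\|f\|]^G$, $f_\sharp(x)(g)=f(gx)$, and let $X_f$ be the closure of $f_\sharp(X)$ in the product (pointwise) topology, with the action $(g\omega)(h)=\omega(hg)$; this is a compact $G$-system. *)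

theory Defs
  imports "HOL-Analysis.Analysis"
begin

text \<open>
  The acting group is a type of class \<open>topological_group_add\<close> together with \<open>t2_space\<close>. This class
  does not assume commutativity: the group operation of \<open>G\<close> is merely written \<open>+\<close>, with unit \<open>0\<close>.
  A Hausdorff topological group is automatically completely regular. Spaces with an action are
  abstract topologies, and only the values of an action on the carrier \<open>topspace X\<close> matter.
\<close>

definition uniformly_Lindelof :: "'g::topological_group_add itself \<Rightarrow> bool" where
  "uniformly_Lindelof _ \<longleftrightarrow>
     (\<forall>U::'g set. 0 \<in> interior U \<longrightarrow> (\<exists>C. countable C \<and> UNIV = {c + u | c u. c \<in> C \<and> u \<in> U}))"

definition G_space :: "'x topology \<Rightarrow> ('g::topological_group_add \<Rightarrow> 'x \<Rightarrow> 'x) \<Rightarrow> bool" where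
  "G_space X a \<longleftrightarrow>
     Hausdorff_space X \<and> completely_regular_space X \<and>
     continuous_map (prod_topology euclidean X) X (\<lambda>(g, x). a g x) \<and>
     (\<forall>x \<in> topspace X. a 0 x = x) \<and>
     (\<forall>g h. \<forall>x \<in> topspace X. a (g + h) x = a g (a h x))"

definition compact_G_system :: "'x topology \<Rightarrow> ('g::topological_group_add \<Rightarrow> 'x \<Rightarrow> 'x) \<Rightarrow> bool" where
  "compact_G_system X a \<longleftrightarrow> G_space X a \<and> compact_space X"

definition G_isomorphism ::
    "'x topology \<Rightarrow> ('g \<Rightarrow> 'x \<Rightarrow> 'x) \<Rightarrow> 'y topology \<Rightarrow> ('g \<Rightarrow> 'y \<Rightarrow> 'y) \<Rightarrow> ('x \<Rightarrow> 'y) \<Rightarrow> bool" where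
  "G_isomorphism X a Y b h \<longleftrightarrow>
     homeomorphic_map X Y h \<and> (\<forall>g. \<forall>x \<in> topspace X. h (a g x) = b g (h x))"

definition G_subsystem :: "'x topology \<Rightarrow> ('g \<Rightarrow> 'x \<Rightarrow> 'x) \<Rightarrow> 'x set \<Rightarrow> bool" where
  "G_subsystem X a S \<longleftrightarrow> closedin X S \<and> (\<forall>g. \<forall>x \<in> S. a g x \<in> S)"

definition product_action ::
    "'i set \<Rightarrow> ('i \<Rightarrow> 'g \<Rightarrow> 'y \<Rightarrow> 'y) \<Rightarrow> 'g \<Rightarrow> ('i \<Rightarrow> 'y) \<Rightarrow> 'i \<Rightarrow> 'y" where
  "product_action I b g y = (\<lambda>i\<in>I. b i g (y i))"

definition embeds_in_metrizable_product ::
    "'x topology \<Rightarrow> ('g::topological_group_add \<Rightarrow> 'x \<Rightarrow> 'x) \<Rightarrow>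
     'i set \<Rightarrow> ('i \<Rightarrow> 'y topology) \<Rightarrow> ('i \<Rightarrow> 'g \<Rightarrow> 'y \<Rightarrow> 'y) \<Rightarrow> bool" where
  "embeds_in_metrizable_product X a I Y b \<longleftrightarrow>
     (\<forall>i \<in> I. compact_G_system (Y i) (b i) \<and> metrizable_space (Y i)) \<and>
     (\<exists>S h. G_subsystem (product_topology Y I) (product_action I b) S \<and>
            G_isomorphism X a (subtopology (product_topology Y I) S) (product_action I b) h)"

text \<open>
  HOL cannot quantify existentially over types, so the type of the indices and the type of the
  points of the factors have to be fixed in advance. The choice below loses no generality:
  a compact metrizable space has at most as many points as \<open>nat \<Rightarrow> real\<close>, and one factor for each
  pair of points of \<open>X\<close> is enough. This is proved as \<open>m_approximableI\<close> below, which accepts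
  products with indices and factors in arbitrary types.
\<close>

definition m_approximable :: "'x topology \<Rightarrow> ('g::topological_group_add \<Rightarrow> 'x \<Rightarrow> 'x) \<Rightarrow> bool" where
  "m_approximable X a \<longleftrightarrow>
     (\<exists>(I :: ('x \<times> 'x) set) (Y :: 'x \<times> 'x \<Rightarrow> (nat \<Rightarrow> real) topology) b.
        embeds_in_metrizable_product X a I Y b)"

text \<open>
  The elements of \<open>cfunspace X euclidean_metric\<close> are the bounded continuous real functions on \<open>X\<close>,
  represented by functions that are \<open>undefined\<close> outside \<open>topspace X\<close>; its metric is the sup metric.
\<close>

definition translate :: "'x topology \<Rightarrow> ('g \<Rightarrow> 'x \<Rightarrow> 'x) \<Rightarrow> 'g \<Rightarrow> ('x \<Rightarrow> real) \<Rightarrow> 'x \<Rightarrow> real" where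
  "translate X a g f = (\<lambda>x\<in>topspace X. f (a g x))"

definition RUC :: "'x topology \<Rightarrow> ('g::topological_group_add \<Rightarrow> 'x \<Rightarrow> 'x) \<Rightarrow> ('x \<Rightarrow> real) set" where
  "RUC X a = {f \<in> mspace (cfunspace X euclidean_metric).
      continuous_map euclidean (mtopology_of (cfunspace X euclidean_metric)) (\<lambda>g. translate X a g f)}"

abbreviation RUC_group :: "('g::topological_group_add \<Rightarrow> real) set" where
  "RUC_group \<equiv> RUC euclidean (+)"

text \<open>
  As usual for Gelfand spaces, the zero functional is excluded. Functionals on \<open>RUC_group\<close> are
  represented by functions that are \<open>undefined\<close> outside \<open>RUC_group\<close>, so that they are points of
  the product of copies of the real line indexed by \<open>RUC_group\<close>, whose topology induces the
  weak* topology.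
\<close>

definition ambit_carrier :: "(('g::topological_group_add \<Rightarrow> real) \<Rightarrow> real) set" where
  "ambit_carrier = {\<phi> \<in> extensional RUC_group.
     (\<forall>f \<in> RUC_group. \<forall>k \<in> RUC_group. \<phi> (\<lambda>x. f x + k x) = \<phi> f + \<phi> k) \<and>
     (\<forall>c. \<forall>f \<in> RUC_group. \<phi> (\<lambda>x. c * f x) = c * \<phi> f) \<and>
     (\<forall>f \<in> RUC_group. \<forall>k \<in> RUC_group. \<phi> (\<lambda>x. f x * k x) = \<phi> f * \<phi> k) \<and>
     (\<exists>f \<in> RUC_group. \<phi> f \<noteq> 0)}"

definition greatest_ambit :: "(('g::topological_group_add \<Rightarrow> real) \<Rightarrow> real) topology" where
  "greatest_ambit = subtopology (product_topology (\<lambda>_. euclideanreal) RUC_group) ambit_carrier"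

definition ambit_action ::
    "'g::topological_group_add \<Rightarrow> (('g \<Rightarrow> real) \<Rightarrow> real) \<Rightarrow> ('g \<Rightarrow> real) \<Rightarrow> real" where
  "ambit_action g \<phi> = (\<lambda>f\<in>RUC_group. \<phi> (translate euclidean (+) g f))"

definition orbit_function :: "('g \<Rightarrow> 'x \<Rightarrow> 'x) \<Rightarrow> ('x \<Rightarrow> real) \<Rightarrow> 'x \<Rightarrow> 'g \<Rightarrow> real" where
  "orbit_function a f x = (\<lambda>g. f (a g x))"

definition sup_norm :: "'x topology \<Rightarrow> ('x \<Rightarrow> real) \<Rightarrow> real" where
  "sup_norm X f = (SUP x\<in>topspace X. \<bar>f x\<bar>)"

definition orbit_cube :: "'x topology \<Rightarrow> ('x \<Rightarrow> real) \<Rightarrow> ('g \<Rightarrow> real) topology" where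
  "orbit_cube X f =
     product_topology (\<lambda>_. subtopology euclideanreal {- sup_norm X f .. sup_norm X f}) UNIV"

text \<open>
  The underlying space of the system \<open>X\<^sub>f\<close>; the action on it is \<open>\<lambda>g \<omega> h. \<omega> (h + g)\<close>, which plays no
  role for metrizability.
\<close>

definition orbit_closure_system ::
    "'x topology \<Rightarrow> ('g \<Rightarrow> 'x \<Rightarrow> 'x) \<Rightarrow> ('x \<Rightarrow> real) \<Rightarrow> ('g \<Rightarrow> real) topology" where
  "orbit_closure_system X a f =
     subtopology (orbit_cube X f) (orbit_cube X f closure_of (orbit_function a f ` topspace X))"

text \<open>
  A formula of HOL cannot quantify over types either, so a statement about all systems of the group
  \<open>'g\<close> ranges over the topologies on one type. We use \<open>'x + (('g \<Rightarrow> real) \<Rightarrow> real)\<close>, where \<open>'x\<close> is an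
  arbitrary type: up to isomorphism every system with points in \<open>'x\<close> occurs there, and so do the
  greatest ambit of \<open>'g\<close> and \<open>'g\<close> itself.
\<close>

lemma homeomorphic_map_pushforward:
  assumes "inj_on j (topspace Y)"
  shows "homeomorphic_map Y (pullback_topology (j ` topspace Y) (inv_into (topspace Y) j) Y) j"
    (is "homeomorphic_map Y ?Z j")
proof -
  let ?k = "inv_into (topspace Y) j"
  have kj: "?k (j x) = x" if "x \<in> topspace Y" for x
    using assms that by simp
  have jk: "j (?k y) = y" if "y \<in> j ` topspace Y" for y
    using that by (rule f_inv_into_f)
  have c1: "continuous_map Y ?Z j"
  proof (rule continuous_map_pullback')
    show "continuous_map Y Y (?k \<circ> j)"
      by (rule continuous_map_eq[OF continuous_map_id]) (simp add: kj)
  qed auto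
  have "continuous_map ?Z Y (id \<circ> ?k)"
    by (rule continuous_map_pullback) (rule continuous_map_id)
  then have c2: "continuous_map ?Z Y ?k" by simp
  have "homeomorphic_maps Y ?Z j ?k"
    unfolding homeomorphic_maps_def
    using c1 c2 by (auto simp: topspace_pullback_topology kj)
  then show ?thesis
    using homeomorphic_maps_map by blast
qed

lemma compact_metrizable_inj_real_sequences:
  assumes "compact_space Y" "metrizable_space Y"
  shows "\<exists>j :: 'y \<Rightarrow> nat \<Rightarrow> real. inj_on j (topspace (Y :: 'y topology))"
proof (cases "topspace Y = {}")
  case False
  obtain M d where "Metric_space M d" and Y: "Y = Metric_space.mtopology M d"
    using assms(2) by (auto simp: metrizable_space_def)
  then interpret Metric_space M d by simp
  have "mtotally_bounded M"
    using assms(1) by (simp add: Y compact_space_eq_mcomplete_mtotally_bounded)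
  then have "\<exists>K. finite K \<and> K \<subseteq> M \<and> M \<subseteq> (\<Union>x\<in>K. mball x (inverse (Suc n)))" for n
    by (simp add: mtotally_bounded_def)
  then obtain K where K: "\<And>n. finite (K n)" "\<And>n. K n \<subseteq> M"
      "\<And>n. M \<subseteq> (\<Union>x\<in>K n. mball x (inverse (Suc n)))"
    by metis
  define C where "C = (\<Union>n. K n)"
  have "countable C"
    using K(1) by (auto simp: C_def intro: countable_finite)
  define j where "j = (\<lambda>x n. d x (from_nat_into C n))"
  have "x = y" if xy: "x \<in> M" "y \<in> M" "j x = j y" for x y
  proof (rule ccontr)
    assume "x \<noteq> y"
    then have "0 < d x y / 2" using xy by simp
    then obtain n where n: "inverse (real (Suc n)) < d x y / 2"
      using reals_Archimedean by blast
    obtain c where c: "c \<in> K n" "x \<in> mball c (inverse (Suc n))"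
      using K(3) xy(1) by blast
    then have "c \<in> C" by (auto simp: C_def)
    then obtain m where "from_nat_into C m = c"
      using from_nat_into_surj[OF \<open>countable C\<close>] by blast
    then have "d x c = d y c"
      using fun_cong[OF xy(3), of m] by (simp add: j_def)
    moreover have "d x c < inverse (Suc n)" "c \<in> M"
      using c(2) by (auto simp: commute)
    ultimately show False
      using triangle[OF xy(1) \<open>c \<in> M\<close> xy(2)] n by (simp add: commute)
  qed
  then have "inj_on j (topspace Y)"
    by (auto simp: Y inj_on_def)
  then show ?thesis by blast
qed auto

lemma G_space_closed:
  assumes "G_space X a" "x \<in> topspace X"
  shows "a g x \<in> topspace X"
proof -
  have "(\<lambda>(g, x). a g x) \<in> UNIV \<times> topspace X \<rightarrow> topspace X"
    using assms(1) by (auto simp: G_space_def continuous_map_def)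
  from funcset_mem[OF this, of "(g, x)"] show ?thesis
    using assms(2) by simp
qed

lemma compact_G_system_transport:
  assumes sys: "compact_G_system Y b" and h: "homeomorphic_maps Y Z j k"
  shows "compact_G_system Z (\<lambda>g z. j (b g (k z)))"
proof -
  have Y: "G_space Y b" "compact_space Y"
    using sys by (auto simp: compact_G_system_def)
  have hom: "Y homeomorphic_space Z"
    using h by (auto simp: homeomorphic_space_def)
  have j: "continuous_map Y Z j" and k: "continuous_map Z Y k"
    and kj: "\<And>x. x \<in> topspace Y \<Longrightarrow> k (j x) = x" and jk: "\<And>z. z \<in> topspace Z \<Longrightarrow> j (k z) = z"
    using h by (auto simp: homeomorphic_maps_def)
  have kt: "k z \<in> topspace Y" if "z \<in> topspace Z" for z
    using k that by (auto simp: continuous_map_def)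
  have "continuous_map (prod_topology euclidean Z) (prod_topology euclidean Y)
          (\<lambda>p. (fst p, k (snd p)))"
    by (intro continuous_intros continuous_map_compose[OF _ k, unfolded o_def])
  moreover have "continuous_map (prod_topology euclidean Y) Y (\<lambda>(g, x). b g x)"
    using Y(1) by (simp add: G_space_def)
  ultimately have "continuous_map (prod_topology euclidean Z) Z
          (j \<circ> ((\<lambda>(g, x). b g x) \<circ> (\<lambda>p. (fst p, k (snd p)))))"
    by (rule continuous_map_compose[OF continuous_map_compose j])
  then have "continuous_map (prod_topology euclidean Z) Z (\<lambda>(g, z). j (b g (k z)))"
    by (simp add: o_def case_prod_unfold)
  moreover have "Hausdorff_space Z" "completely_regular_space Z" "compact_space Z"
    using Y homeomorphic_Hausdorff_space[OF hom] homeomorphic_completely_regular_space[OF hom]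
      homeomorphic_compact_space[OF hom] by (simp_all add: G_space_def)
  moreover have "k (j (b g (k z))) = b g (k z)" if "z \<in> topspace Z" for g z
    using kj G_space_closed[OF Y(1)] kt that by blast
  ultimately show ?thesis
    using Y(1) kt jk by (auto simp: compact_G_system_def G_space_def)
qed

lemma m_approximableI:
  fixes X :: "'x topology" and a :: "'g::topological_group_add \<Rightarrow> 'x \<Rightarrow> 'x"
    and I :: "'i set" and Y :: "'i \<Rightarrow> 'y topology"
  assumes X: "compact_G_system X a" and emb: "embeds_in_metrizable_product X a I Y b"
  shows "m_approximable X a"
proof -
  have Y: "\<And>i. i \<in> I \<Longrightarrow> compact_G_system (Y i) (b i)" "\<And>i. i \<in> I \<Longrightarrow> metrizable_space (Y i)"
    using emb by (auto simp: embeds_in_metrizable_product_def)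
  obtain S h where S: "G_subsystem (product_topology Y I) (product_action I b) S"
    and h: "G_isomorphism X a (subtopology (product_topology Y I) S) (product_action I b) h"
    using emb by (auto simp: embeds_in_metrizable_product_def)
  have hcont: "continuous_map X (product_topology Y I) h"
    using h homeomorphic_imp_continuous_map continuous_map_in_subtopology
    unfolding G_isomorphism_def by blast
  have hinj: "inj_on h (topspace X)"
    using h homeomorphic_imp_injective_map unfolding G_isomorphism_def by blast
  have heq: "h (a g x) i = b i g (h x i)" if "x \<in> topspace X" "i \<in> I" for g x i
    using h that by (simp add: G_isomorphism_def product_action_def)
  have hE: "h x \<in> (\<Pi>\<^sub>E i\<in>I. topspace (Y i))" if "x \<in> topspace X" for x
    using hcont that by (auto simp: continuous_map_def)
  have hcoord: "continuous_map X (Y i) (\<lambda>x. h x i)" if "i \<in> I" for i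
    using hcont that by (simp add: continuous_map_componentwise)
  have "\<forall>i\<in>I. \<exists>j :: 'y \<Rightarrow> nat \<Rightarrow> real. inj_on j (topspace (Y i))"
    using Y compact_metrizable_inj_real_sequences by (auto simp: compact_G_system_def)
  then obtain j :: "'i \<Rightarrow> 'y \<Rightarrow> nat \<Rightarrow> real" where j: "\<And>i. i \<in> I \<Longrightarrow> inj_on (j i) (topspace (Y i))"
    by metis
  define Z where
    "Z i = pullback_topology (j i ` topspace (Y i)) (inv_into (topspace (Y i)) (j i)) (Y i)" for i
  have "\<forall>i\<in>I. \<exists>k. homeomorphic_maps (Y i) (Z i) (j i) k"
    using homeomorphic_map_pushforward[OF j] by (simp add: Z_def homeomorphic_map_maps)
  then obtain k where k: "\<And>i. i \<in> I \<Longrightarrow> homeomorphic_maps (Y i) (Z i) (j i) (k i)"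
    by metis
  define c where "c i = (\<lambda>g z. j i (b i g (k i z)))" for i
  have Z: "compact_G_system (Z i) (c i)" "metrizable_space (Z i)" if "i \<in> I" for i
  proof -
    show "compact_G_system (Z i) (c i)"
      using compact_G_system_transport[OF Y(1) k] that by (simp add: c_def)
    have "Y i homeomorphic_space Z i"
      using k[OF that] by (auto simp: homeomorphic_space_def)
    from homeomorphic_metrizable_space[OF this] show "metrizable_space (Z i)"
      using Y(2)[OF that] by simp
  qed
  define J where "J = {(x, y). x \<in> topspace X \<and> y \<in> topspace X \<and> x \<noteq> y}"
  have "\<exists>i\<in>I. h (fst p) i \<noteq> h (snd p) i" if p: "p \<in> J" for p
  proof -
    have "fst p \<in> topspace X" "snd p \<in> topspace X" "fst p \<noteq> snd p"
      using p by (auto simp: J_def)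
    moreover from this have "h (fst p) \<noteq> h (snd p)"
      using inj_on_eq_iff[OF hinj] by simp
    ultimately have ne: "h (fst p) \<noteq> h (snd p)" and E: "h (fst p) \<in> (\<Pi>\<^sub>E i\<in>I. topspace (Y i))"
        "h (snd p) \<in> (\<Pi>\<^sub>E i\<in>I. topspace (Y i))"
      using hE by simp_all
    show ?thesis
    proof (rule ccontr)
      assume "\<not> ?thesis"
      then have "h (fst p) = h (snd p)"
        by (intro PiE_ext[OF E]) simp
      with ne show False by contradiction
    qed
  qed
  then have "\<forall>p\<in>J. \<exists>i. i \<in> I \<and> h (fst p) i \<noteq> h (snd p) i"
    by blast
  from bchoice[OF this] obtain s where s: "\<And>p. p \<in> J \<Longrightarrow> s p \<in> I"
      "\<And>p. p \<in> J \<Longrightarrow> h (fst p) (s p) \<noteq> h (snd p) (s p)"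
    by blast
  let ?P = "product_topology (Z \<circ> s) J" and ?c = "product_action J (c \<circ> s)"
  define f where "f x = (\<lambda>p\<in>J. j (s p) (h x (s p)))" for x
  have fcont: "continuous_map X ?P f"
    unfolding continuous_map_componentwise
  proof (intro conjI ballI)
    fix p assume p: "p \<in> J"
    have "continuous_map (Y (s p)) (Z (s p)) (j (s p))"
      using k[OF s(1)[OF p]] by (simp add: homeomorphic_maps_def)
    from continuous_map_compose[OF hcoord[OF s(1)[OF p]] this] p
    show "continuous_map X ((Z \<circ> s) p) (\<lambda>x. f x p)"
      by (simp add: f_def o_def)
  qed (auto simp: f_def)
  have htop: "h x i \<in> topspace (Y i)" if "x \<in> topspace X" "i \<in> I" for x i
    using PiE_mem[OF hE] that by simp
  have finj: "inj_on f (topspace X)"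
  proof (rule inj_onI, rule ccontr)
    fix x y assume xy: "x \<in> topspace X" "y \<in> topspace X" "f x = f y" "x \<noteq> y"
    then have p: "(x, y) \<in> J" by (simp add: J_def)
    have "j (s (x, y)) (h x (s (x, y))) = j (s (x, y)) (h y (s (x, y)))"
      using fun_cong[OF xy(3), of "(x, y)"] p by (simp add: f_def)
    then have "h x (s (x, y)) = h y (s (x, y))"
      using j[OF s(1)[OF p]] htop[OF _ s(1)[OF p]] xy by (auto dest: inj_onD)
    then show False using s(2)[OF p] by simp
  qed
  have XH: "compact_space X" "G_space X a"
    using X by (auto simp: compact_G_system_def)
  have PH: "Hausdorff_space ?P"
    using Z(1) s(1) by (auto simp: Hausdorff_space_product_topology compact_G_system_def G_space_def)
  have feq: "f (a g x) = ?c g (f x)" if x: "x \<in> topspace X" for g x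
  proof
    fix p
    show "f (a g x) p = ?c g (f x) p"
    proof (cases "p \<in> J")
      case True
      have "k (s p) (j (s p) (h x (s p))) = h x (s p)"
        using k[OF s(1)[OF True]] htop[OF x s(1)[OF True]] by (simp add: homeomorphic_maps_def)
      then show ?thesis
        using True heq[OF x s(1)[OF True]] by (simp add: f_def product_action_def c_def)
    qed (simp add: f_def product_action_def)
  qed
  have fclosed: "closed_map X ?P f"
    using continuous_imp_closed_map[OF fcont XH(1) PH] .
  have "embedding_map X ?P f"
    using injective_closed_imp_embedding_map[OF fcont fclosed finj] .
  then have "homeomorphic_map X (subtopology ?P (f ` topspace X)) f"
    by (simp add: embedding_map_def)
  moreover have "closedin ?P (f ` topspace X)"
    using fclosed by (simp add: closed_map_def)
  moreover have "?c g z \<in> f ` topspace X" if "z \<in> f ` topspace X" for g z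
  proof -
    obtain x where x: "x \<in> topspace X" "z = f x" using \<open>z \<in> f ` topspace X\<close> by blast
    then show ?thesis
      using feq[OF x(1), of g] G_space_closed[OF XH(2) x(1), of g] by (metis imageI)
  qed
  ultimately have "G_subsystem ?P ?c (f ` topspace X)"
      "G_isomorphism X a (subtopology ?P (f ` topspace X)) ?c f"
    using feq by (simp_all add: G_subsystem_def G_isomorphism_def)
  moreover have "\<forall>p\<in>J. compact_G_system ((Z \<circ> s) p) ((c \<circ> s) p) \<and> metrizable_space ((Z \<circ> s) p)"
    using Z s(1) by simp
  ultimately have "embeds_in_metrizable_product X a J (Z \<circ> s) (c \<circ> s)"
    unfolding embeds_in_metrizable_product_def by blast
  then show ?thesis
    unfolding m_approximable_def by blast
qed

end

theory Submission
  imports Defs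
begin

text \<open>
  Call the orbit of a function on a system separable if some countable set of its translates is
  dense in the set of all translates for the sup norm (\<open>orbit_separable\<close>). This links the conditions.

  If the group is uniformly Lindelof, then each \<open>X\<^sub>f\<close> is metrizable, because its points are
  functions on the group with a common modulus of uniform continuity and are therefore determined by
  their values on a countable set (\<open>uniformly_Lindelof_imp_metrizable_orbit_closure\<close>).
  A compact system embeds in the product of its systems \<open>X\<^sub>f\<close>, so it is m-approximable
  (\<open>uniformly_Lindelof_imp_m_approximable\<close>). The greatest ambit is a compact system (\<open>compact_G_system_greatest_ambit\<close>), so this
  includes its case.

  Conversely, each of the other three conditions makes the orbits of the functions
  \<open>\<phi> \<mapsto> \<phi> f\<close> on the greatest ambit separable. If \<open>X\<close> is m-approximable, a continuous function on
  \<open>X\<close> depends on countably many coordinates, so all its translates live on one compact metrizable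
  space, whose continuous functions form a separable space (\<open>m_approximable_imp_orbit_separable\<close>).
  If \<open>X\<^sub>f\<close> is metrizable, the translates of \<open>f\<close> are evaluations on the compact metrizable space \<open>X\<^sub>f\<close>
  (\<open>metrizable_orbit_closure_imp_orbit_separable\<close>). The conditions that quantify over all systems are
  applied to the greatest ambit itself, which is a compact system.

  Finally, separability of these orbits is applied to a right uniformly continuous bump function
  supported in a given neighborhood of the identity, which exists by the construction of Birkhoff
  and Kakutani (\<open>ex_RUC_group_bump\<close>). Two translates of a bump function that are close to each other
  in the sup norm come from group elements that differ by an element of the neighborhood
  (\<open>uniformly_LindelofI_orbit_separable\<close>).
\<close>

section \<open>Continuous families of real functions on compact spaces\<close>

lemma compactin_finite_index:
  assumes "compactin X S" "\<And>i. i \<in> A \<Longrightarrow> openin X (U i)" "S \<subseteq> (\<Union>i\<in>A. U i)"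
  obtains B where "finite B" "B \<subseteq> A" "S \<subseteq> (\<Union>i\<in>B. U i)"
proof -
  obtain F where "finite F" "F \<subseteq> U ` A" "S \<subseteq> \<Union>F"
    using assms unfolding compactin_def by (metis (no_types, lifting) imageE)
  then show ?thesis
    using finite_subset_image[of F U A] that by blast
qed

lemma compact_Hausdorff_imp_completely_regular_space:
  "compact_space X \<Longrightarrow> Hausdorff_space X \<Longrightarrow> completely_regular_space X"
  using compact_Hausdorff_or_regular_imp_normal_space normal_imp_completely_regular_space by blast

lemma continuous_map_realI:
  assumes "\<And>x e. x \<in> topspace X \<Longrightarrow> e > 0 \<Longrightarrow>
             \<exists>U. openin X U \<and> x \<in> U \<and> (\<forall>y\<in>U. \<bar>f y - f x\<bar> < e)"
  shows "continuous_map X euclideanreal f"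
proof -
  have "continuous_map X Met_TC.mtopology f"
    unfolding Met_TC.continuous_map_to_metric
    using assms by (simp add: dist_real_def abs_minus_commute)
  then show ?thesis by simp
qed

lemma openin_preimage_real_ball:
  assumes "continuous_map X euclideanreal f"
  shows "openin X {y \<in> topspace X. \<bar>f y - c\<bar> < e}"
proof -
  have "{y \<in> topspace X. \<bar>f y - c\<bar> < e} = {y \<in> topspace X. f y \<in> ball c e}"
    by (auto simp: dist_real_def abs_minus_commute)
  then show ?thesis
    using openin_continuous_map_preimage[OF assms, of "ball c e"] by simp
qed

text \<open>
  Separate continuity gives joint continuity if the dependence on the group element is uniform over
  the space. Both the action on an orbit closure and the action on the greatest ambit are proved
  continuous in this way.
\<close>

lemma continuous_map_joint:
  fixes p :: "'g::topological_space \<Rightarrow> 'y \<Rightarrow> real"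
  assumes cont: "\<And>g. continuous_map Y euclideanreal (p g)"
    and unif: "\<And>g. uniform_limit (topspace Y) p (p g) (nhds g)"
  shows "continuous_map (prod_topology euclidean Y) euclideanreal (\<lambda>z. p (fst z) (snd z))"
proof (rule continuous_map_realI)
  fix z :: "'g \<times> 'y" and e :: real
  assume z: "z \<in> topspace (prod_topology euclidean Y)" and e: "e > 0"
  obtain g y where zz: "z = (g, y)" by (cases z)
  have y: "y \<in> topspace Y" using z zz by simp
  have "\<forall>\<^sub>F h in nhds g. \<forall>y\<in>topspace Y. dist (p h y) (p g y) < e / 2"
    using uniform_limitD[OF unif half_gt_zero[OF e]] .
  then obtain U where U: "open U" "g \<in> U"
      "\<And>h y. h \<in> U \<Longrightarrow> y \<in> topspace Y \<Longrightarrow> \<bar>p h y - p g y\<bar> < e / 2"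
    by (auto simp: eventually_nhds dist_real_def)
  define V where "V = {v \<in> topspace Y. \<bar>p g v - p g y\<bar> < e / 2}"
  have "openin Y V" "y \<in> V"
    unfolding V_def using openin_preimage_real_ball[OF cont, of g "p g y" "e / 2"] y e by simp_all
  moreover have "\<bar>p h v - p g y\<bar> < e" if "h \<in> U" "v \<in> V" for h v
  proof -
    have "\<bar>p h v - p g v\<bar> < e / 2" "\<bar>p g v - p g y\<bar> < e / 2"
      using U(3)[of h v] that unfolding V_def by blast+
    then show ?thesis by linarith
  qed
  ultimately show "\<exists>U. openin (prod_topology euclidean Y) U \<and> z \<in> U \<and>
      (\<forall>w\<in>U. \<bar>p (fst w) (snd w) - p (fst z) (snd z)\<bar> < e)"
    using U zz by (intro exI[of _ "U \<times> V"]) (auto simp: openin_prod_Times_iff)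
qed

lemma compact_metrizable_imp_second_countable:
  assumes "compact_space Y" "metrizable_space Y"
  shows "second_countable Y"
proof -
  obtain M d where "Metric_space M d" and Y: "Y = Metric_space.mtopology M d"
    using assms(2) by (auto simp: metrizable_space_def)
  then interpret Metric_space M d by simp
  have "mtotally_bounded M"
    using assms(1) by (simp add: Y compact_space_eq_mcomplete_mtotally_bounded)
  then have "\<exists>K. finite K \<and> K \<subseteq> M \<and> M \<subseteq> (\<Union>x\<in>K. mball x (inverse (Suc n)))" for n
    by (simp add: mtotally_bounded_def)
  then obtain K where K: "\<And>n. finite (K n)" "\<And>n. K n \<subseteq> M"
      "\<And>n. M \<subseteq> (\<Union>x\<in>K n. mball x (inverse (Suc n)))"
    by metis
  define B where "B = (\<Union>n. (\<lambda>x. mball x (inverse (Suc n))) ` K n)"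
  have "countable B"
    using K(1) by (auto simp: B_def intro: countable_finite)
  moreover have "\<exists>V\<in>B. y \<in> V \<and> V \<subseteq> U" if U: "openin Y U" "y \<in> U" for U y
  proof -
    obtain r where r: "r > 0" "mball y r \<subseteq> U"
      using U by (auto simp: Y openin_mtopology)
    have y: "y \<in> M" using U openin_subset by (fastforce simp: Y)
    obtain n where n: "inverse (real (Suc n)) < r / 2"
      using r(1) reals_Archimedean[of "r / 2"] by auto
    obtain x where x: "x \<in> K n" "y \<in> mball x (inverse (Suc n))"
      using K(3) y by blast
    have "mball x (inverse (Suc n)) \<subseteq> mball y r"
    proof
      fix z assume z: "z \<in> mball x (inverse (Suc n))"
      then have "d y z \<le> d y x + d x z"
        using x y by (intro triangle) auto
      then show "z \<in> mball y r"
        using z x n y by (auto simp: commute)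
    qed
    moreover have "mball x (inverse (Suc n)) \<in> B"
      using x(1) unfolding B_def by blast
    ultimately show ?thesis
      using x(2) r(2) by (meson order_trans)
  qed
  moreover have "\<forall>V\<in>B. openin Y V"
    by (auto simp: B_def Y)
  ultimately show ?thesis
    unfolding second_countable_def by blast
qed

text \<open>
  A form of the separability of \<open>C(Y)\<close>. By compactness, each function of the family is described
  up to \<open>e / 2\<close> by a finite set of pairs of a basic open set and a rational number, and there are only
  countably many such finite sets. One function for each finite set that describes some function
  gives the net.
\<close>

lemma countable_uniform_net:
  fixes p :: "'k \<Rightarrow> 'y \<Rightarrow> real"
  assumes "compact_space Y" "second_countable Y"
    and p: "\<And>k. continuous_map Y euclideanreal (p k)" and e: "e > 0"
  shows "\<exists>C. countable C \<and> (\<forall>k. \<exists>c\<in>C. \<forall>y\<in>topspace Y. \<bar>p k y - p c y\<bar> < e)"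
proof -
  obtain B where B: "countable B" "\<And>V. V \<in> B \<Longrightarrow> openin Y V"
      "\<And>U x. openin Y U \<Longrightarrow> x \<in> U \<Longrightarrow> \<exists>V \<in> B. x \<in> V \<and> V \<subseteq> U"
    using assms(2) unfolding second_countable_def by metis
  define fits where "fits D k \<longleftrightarrow>
      topspace Y \<subseteq> (\<Union>D'\<in>D. fst D') \<and> (\<forall>D'\<in>D. \<forall>y\<in>fst D'. \<bar>p k y - snd D'\<bar> < e / 2)" for D k
  define \<D> where "\<D> = {D. D \<subseteq> B \<times> (\<rat> :: real set) \<and> finite D}"
  have "countable \<D>"
    unfolding \<D>_def using countable_Collect_finite_subset[of "B \<times> (\<rat> :: real set)"]
      countable_SIGMA[OF B(1) countable_rat]
    by (simp add: conj_commute)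
  have ex: "\<exists>D\<in>\<D>. fits D k" for k
  proof -
    define A where "A = {(V, q). V \<in> B \<and> q \<in> \<rat> \<and> (\<forall>y\<in>V. \<bar>p k y - q\<bar> < e / 2)}"
    have "topspace Y \<subseteq> (\<Union>D'\<in>A. fst D')"
    proof
      fix y assume y: "y \<in> topspace Y"
      obtain q where q: "q \<in> \<rat>" "p k y < q" "q < p k y + e / 2"
        using Rats_dense_in_real[of "p k y" "p k y + e / 2"] e by auto
      define U where "U = {z \<in> topspace Y. \<bar>p k z - q\<bar> < e / 2}"
      have "openin Y U" "y \<in> U"
        unfolding U_def using openin_preimage_real_ball[OF p, of k q "e / 2"] y q by auto
      then obtain V where "V \<in> B" "y \<in> V" "V \<subseteq> U"
        using B(3) by blast
      then show "y \<in> (\<Union>D'\<in>A. fst D')"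
        using q(1) by (force simp: A_def U_def)
    qed
    moreover have "compactin Y (topspace Y)"
      using assms(1) by (simp add: compact_space_def)
    moreover have "openin Y (fst D')" if "D' \<in> A" for D'
      using that B(2) by (auto simp: A_def)
    ultimately obtain D where "finite D" "D \<subseteq> A" "topspace Y \<subseteq> (\<Union>D'\<in>D. fst D')"
      using compactin_finite_index[of Y "topspace Y" A fst] by blast
    then have "D \<in> \<D>" "fits D k"
      by (auto simp: \<D>_def A_def fits_def)
    then show ?thesis by blast
  qed
  define C where "C = (\<lambda>D. SOME k. fits D k) ` \<D>"
  have "\<exists>c\<in>C. \<forall>y\<in>topspace Y. \<bar>p k y - p c y\<bar> < e" for k
  proof -
    obtain D where D: "D \<in> \<D>" "fits D k" using ex by blast
    define c where "c = (SOME k. fits D k)"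
    have c: "fits D c" using D(2) unfolding c_def by (rule someI)
    have "\<bar>p k y - p c y\<bar> < e" if y: "y \<in> topspace Y" for y
    proof -
      obtain D' where "D' \<in> D" "y \<in> fst D'"
        using D(2) y unfolding fits_def by blast
      then have "\<bar>p k y - snd D'\<bar> < e / 2" "\<bar>p c y - snd D'\<bar> < e / 2"
        using D(2) c unfolding fits_def by blast+
      then show ?thesis by linarith
    qed
    then show ?thesis
      using D(1) by (auto simp: C_def c_def)
  qed
  moreover have "countable C"
    using \<open>countable \<D>\<close> by (simp add: C_def)
  ultimately show ?thesis by blast
qed

section \<open>Separable orbits of functions on m-approximable systems\<close>

text \<open>
  Separability of the set of translates of \<open>F\<close> in the sup norm, with the countable set allowed to
  depend on the precision.
\<close>

definition orbit_separable :: "'x topology \<Rightarrow> ('g \<Rightarrow> 'x \<Rightarrow> 'x) \<Rightarrow> ('x \<Rightarrow> real) \<Rightarrow> bool" where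
  "orbit_separable X a F \<longleftrightarrow>
     (\<forall>e>0. \<exists>C. countable C \<and> (\<forall>g. \<exists>c\<in>C. \<forall>x\<in>topspace X. \<bar>F (a g x) - F (a c x)\<bar> < e))"

text \<open>
  On a compact space \<open>X\<close>, the set of pairs of points that \<open>F\<close> separates by at least
  \<open>1 / (n + 1)\<close> is compact, so finitely many coordinates already separate all of them. The union of
  these finite sets of coordinates over all \<open>n\<close> determines \<open>F\<close>.
\<close>

lemma continuous_function_countable_coordinates:
  fixes F :: "'x \<Rightarrow> real"
  assumes X: "compact_space X" and Y: "\<And>i. i \<in> I \<Longrightarrow> Hausdorff_space (Y i)"
    and h: "\<And>i. i \<in> I \<Longrightarrow> continuous_map X (Y i) (\<lambda>x. h x i)"
    and sep: "\<And>x y. x \<in> topspace X \<Longrightarrow> y \<in> topspace X \<Longrightarrow> x \<noteq> y \<Longrightarrow> \<exists>i\<in>I. h x i \<noteq> h y i"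
    and F: "continuous_map X euclideanreal F"
  obtains J where "countable J" "J \<subseteq> I"
    "\<And>x y. x \<in> topspace X \<Longrightarrow> y \<in> topspace X \<Longrightarrow> (\<And>i. i \<in> J \<Longrightarrow> h x i = h y i) \<Longrightarrow> F x = F y"
proof -
  let ?X2 = "prod_topology X X"
  define K where "K n = {z \<in> topspace ?X2. F (fst z) - F (snd z) \<in> - ball 0 (inverse (real (Suc n)))}"
    for n
  have FF: "continuous_map ?X2 euclideanreal (\<lambda>z. F (fst z) - F (snd z))"
    using continuous_map_compose[OF continuous_map_fst F] continuous_map_compose[OF continuous_map_snd F]
    by (intro continuous_map_diff) (auto simp: o_def)
  have "closedin ?X2 (K n)" for n
    unfolding K_def by (rule closedin_continuous_map_preimage[OF FF])
      (simp only: closed_closedin[symmetric] closed_Compl open_ball)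
  then have K: "compactin ?X2 (K n)" for n
    using X closedin_compact_space compact_space_prod_topology by blast
  define U where "U i = {z \<in> topspace ?X2. h (fst z) i \<noteq> h (snd z) i}" for i
  have U: "openin ?X2 (U i)" if "i \<in> I" for i
  proof -
    have "continuous_map ?X2 (Y i) (\<lambda>z. h (fst z) i)" "continuous_map ?X2 (Y i) (\<lambda>z. h (snd z) i)"
      using continuous_map_compose[OF continuous_map_fst h[OF that]]
        continuous_map_compose[OF continuous_map_snd h[OF that]] by (auto simp: o_def)
    from closedin_continuous_maps_eq[OF Y[OF that] this]
    have "openin ?X2 (topspace ?X2 - {z \<in> topspace ?X2. h (fst z) i = h (snd z) i})"
      by blast
    moreover have "topspace ?X2 - {z \<in> topspace ?X2. h (fst z) i = h (snd z) i} = U i"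
      by (auto simp: U_def)
    ultimately show ?thesis by simp
  qed
  have "\<exists>J. finite J \<and> J \<subseteq> I \<and> K n \<subseteq> (\<Union>i\<in>J. U i)" for n
  proof -
    have "K n \<subseteq> (\<Union>i\<in>I. U i)"
    proof
      fix z assume z: "z \<in> K n"
      then have "fst z \<noteq> snd z"
        by (auto simp: K_def)
      then show "z \<in> (\<Union>i\<in>I. U i)"
        using z sep[of "fst z" "snd z"] by (auto simp: K_def U_def mem_Times_iff)
    qed
    from compactin_finite_index[OF K U this] show ?thesis by metis
  qed
  then obtain J where J: "\<And>n. finite (J n)" "\<And>n. J n \<subseteq> I" "\<And>n. K n \<subseteq> (\<Union>i\<in>J n. U i)"
    by metis
  show ?thesis
  proof
    show "countable (\<Union>n. J n)" using J(1) by (auto intro: countable_finite)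
    show "(\<Union>n. J n) \<subseteq> I" using J(2) by blast
    fix x y assume xy: "x \<in> topspace X" "y \<in> topspace X"
      and eq: "\<And>i. i \<in> (\<Union>n. J n) \<Longrightarrow> h x i = h y i"
    show "F x = F y"
    proof (rule ccontr)
      assume "F x \<noteq> F y"
      then obtain n where "inverse (real (Suc n)) < \<bar>F x - F y\<bar>"
        using reals_Archimedean[of "\<bar>F x - F y\<bar>"] by auto
      then have "(x, y) \<in> K n" using xy by (auto simp: K_def)
      then show False using J(3) eq by (force simp: U_def)
    qed
  qed
qed

text \<open>
  Embedded in a product of metrizable systems, \<open>X\<close> projects onto a compact metrizable set \<open>Q\<close> of
  countably many coordinates, chosen so that \<open>F\<close> factors through it. Since the projection is
  equivariant, all translates of \<open>F\<close> factor through \<open>Q\<close> as well, and a family of continuous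
  functions on \<open>Q\<close> has a countable net.
\<close>

lemma m_approximable_imp_orbit_separable:
  fixes X :: "'x topology" and a :: "'g::topological_group_add \<Rightarrow> 'x \<Rightarrow> 'x"
  assumes X: "compact_G_system X a" and m: "m_approximable X a"
    and F: "continuous_map X euclideanreal F"
  shows "orbit_separable X a F"
proof -
  obtain I :: "('x \<times> 'x) set" and Y :: "'x \<times> 'x \<Rightarrow> (nat \<Rightarrow> real) topology" and b
    where emb: "embeds_in_metrizable_product X a I Y b"
    using m by (auto simp: m_approximable_def)
  have Y: "\<And>i. i \<in> I \<Longrightarrow> compact_G_system (Y i) (b i)" "\<And>i. i \<in> I \<Longrightarrow> metrizable_space (Y i)"
    using emb by (auto simp: embeds_in_metrizable_product_def)
  obtain S h where h: "G_isomorphism X a (subtopology (product_topology Y I) S) (product_action I b) h"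
    using emb by (auto simp: embeds_in_metrizable_product_def)
  have hcont: "continuous_map X (product_topology Y I) h"
    using h homeomorphic_imp_continuous_map continuous_map_in_subtopology
    unfolding G_isomorphism_def by blast
  have hinj: "inj_on h (topspace X)"
    using h homeomorphic_imp_injective_map unfolding G_isomorphism_def by blast
  have heq: "h (a g x) i = b i g (h x i)" if "x \<in> topspace X" "i \<in> I" for g x i
    using h that by (simp add: G_isomorphism_def product_action_def)
  have hcoord: "continuous_map X (Y i) (\<lambda>x. h x i)" if "i \<in> I" for i
    using hcont that by (simp add: continuous_map_componentwise)
  have hE: "h x \<in> (\<Pi>\<^sub>E i\<in>I. topspace (Y i))" if "x \<in> topspace X" for x
    using hcont that by (auto simp: continuous_map_def)
  have sep: "\<exists>i\<in>I. h x i \<noteq> h y i" if "x \<in> topspace X" "y \<in> topspace X" "x \<noteq> y" for x y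
    using PiE_ext[OF hE[OF that(1)] hE[OF that(2)]] inj_onD[OF hinj _ that(1,2)] that(3) by blast
  have comp: "compact_space X" and GX: "G_space X a"
    using X by (auto simp: compact_G_system_def)
  have YH: "Hausdorff_space (Y i)" if "i \<in> I" for i
    using Y(1)[OF that] by (simp add: compact_G_system_def G_space_def)
  obtain J where J: "countable J" "J \<subseteq> I"
    "\<And>x y. x \<in> topspace X \<Longrightarrow> y \<in> topspace X \<Longrightarrow> (\<And>i. i \<in> J \<Longrightarrow> h x i = h y i) \<Longrightarrow> F x = F y"
    using continuous_function_countable_coordinates[where h = h and Y = Y,
        OF comp YH hcoord sep F] by blast
  define T where "T x = (\<lambda>i\<in>J. h x i)" for x
  let ?P = "product_topology Y J"
  define Q where "Q = subtopology ?P (T ` topspace X)"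
  have Tcont: "continuous_map X ?P T"
    using hcoord J(2) by (auto simp: continuous_map_componentwise T_def subset_iff)
  have PH: "Hausdorff_space ?P"
    using YH J(2) by (auto simp: Hausdorff_space_product_topology)
  have TQ: "continuous_map X Q T" and topQ: "topspace Q = T ` topspace X"
    using Tcont continuous_map_image_subset_topspace[OF Tcont]
    by (auto simp: Q_def continuous_map_in_subtopology)
  have quot: "quotient_map X Q T"
    using TQ comp Hausdorff_space_subtopology[OF PH] topQ
    by (intro T1_Spaces.continuous_imp_quotient_map) (auto simp: Q_def)
  have Qcomp: "compact_space Q"
    using comp TQ topQ by (metis compact_space_def image_compactin)
  have "metrizable_space ?P"
    unfolding metrizable_space_product_topology
    using J(1,2) Y(2) by (auto intro: countable_subset[of _ J])
  then have "second_countable Q"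
    using Qcomp by (intro compact_metrizable_imp_second_countable)
      (auto simp: Q_def metrizable_space_subtopology)
  note Q = Qcomp this
  have "\<exists>p. continuous_map Q euclideanreal p \<and> (\<forall>x\<in>topspace X. p (T x) = F (a g x))" for g
  proof -
    have "continuous_map X (prod_topology euclidean X) (\<lambda>x. (g, x))"
      by (intro continuous_intros) auto
    then have "continuous_map X X (\<lambda>x. a g x)"
      using GX continuous_map_compose[of X "prod_topology euclidean X" "\<lambda>x. (g, x)" X "\<lambda>(g, x). a g x"]
      by (simp add: G_space_def o_def)
    then have cont: "continuous_map X euclideanreal (\<lambda>x. F (a g x))"
      using continuous_map_compose[OF _ F] by (simp add: o_def)
    have fib: "F (a g x) = F (a g y)" if xy: "x \<in> topspace X" "y \<in> topspace X" "T x = T y" for x y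
    proof (rule J(3))
      show "a g x \<in> topspace X" "a g y \<in> topspace X"
        using xy G_space_closed[OF GX] by auto
      fix i assume i: "i \<in> J"
      then have "h x i = h y i"
        using fun_cong[OF xy(3), of i] by (simp add: T_def)
      then show "h (a g x) i = h (a g y) i"
        using heq[OF xy(1), of i g] heq[OF xy(2), of i g] J(2) i by auto
    qed
    show ?thesis
      by (rule quotient_map_lift_exists[OF quot cont fib]) auto
  qed
  then obtain p where p: "\<And>g. continuous_map Q euclideanreal (p g)"
      "\<And>g x. x \<in> topspace X \<Longrightarrow> p g (T x) = F (a g x)"
    by metis
  show ?thesis
    unfolding orbit_separable_def
  proof (intro allI impI)
    fix e :: real assume "e > 0"
    from countable_uniform_net[OF Q p(1) this]
    show "\<exists>C. countable C \<and> (\<forall>g. \<exists>c\<in>C. \<forall>x\<in>topspace X. \<bar>F (a g x) - F (a c x)\<bar> < e)"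
      by (simp add: topQ p(2))
  qed
qed

section \<open>Right uniformly continuous functions on a space with an action\<close>

text \<open>
  A \<open>G_space\<close> without separation axioms. The point is that the left translation action of a
  topological group on itself can be used at once, without first proving that groups are completely
  regular.
\<close>

locale continuous_action =
  fixes X :: "'x topology" and a :: "'g::topological_group_add \<Rightarrow> 'x \<Rightarrow> 'x"
  assumes continuous_action: "continuous_map (prod_topology euclidean X) X (\<lambda>(g, x). a g x)"
    and action_zero: "x \<in> topspace X \<Longrightarrow> a 0 x = x"
    and action_add: "x \<in> topspace X \<Longrightarrow> a (g + h) x = a g (a h x)"
begin

lemma continuous_translation: "continuous_map X X (a g)"
proof -
  have "continuous_map X (prod_topology euclidean X) (\<lambda>x. (g, x))"
    by (intro continuous_intros) auto
  from continuous_map_compose[OF this continuous_action] show ?thesis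
    by (simp add: o_def)
qed

lemma action_closed: "x \<in> topspace X \<Longrightarrow> a g x \<in> topspace X"
  using continuous_map_funspace[OF continuous_translation[of g]] by blast

lemma uniform_limit_translates:
  assumes "uniform_limit (topspace X) (\<lambda>g x. f (a g x)) f (nhds 0)"
  shows "uniform_limit (topspace X) (\<lambda>h x. f (a h x)) (\<lambda>x. f (a g x)) (nhds g)"
proof -
  have "((\<lambda>h. h - g) \<longlongrightarrow> g - g) (nhds g)"
    by (intro tendsto_intros filterlim_ident)
  then have "filterlim (\<lambda>h. h - g) (nhds 0) (nhds g)"
    by simp
  from filterlim_compose[OF assms this]
  have "uniform_limit (topspace X) (\<lambda>h x. f (a (h - g) x)) f (nhds g)" .
  from uniform_limit_compose'[OF this, of "a g" "topspace X"]
  have "uniform_limit (topspace X) (\<lambda>h x. f (a (h - g) (a g x))) (\<lambda>x. f (a g x)) (nhds g)"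
    using action_closed by blast
  then show ?thesis
    by (rule uniform_limit_cong[THEN iffD1, rotated -1])
      (auto simp: action_add[symmetric])
qed

text \<open>
  By the group law, continuity of the orbit map at the identity implies continuity everywhere. So
  membership in \<open>RUC\<close> comes down to a single uniform limit, and uniform limits are stable under the
  algebraic operations.
\<close>

lemma RUC_iff:
  "f \<in> RUC X a \<longleftrightarrow> f \<in> extensional (topspace X) \<and> continuous_map X euclideanreal f \<and>
     bounded (f ` topspace X) \<and> uniform_limit (topspace X) (\<lambda>g x. f (a g x)) f (nhds 0)"
    (is "_ \<longleftrightarrow> ?R")
proof -
  let ?m = "cfunspace X (euclidean_metric :: real metric)"
  interpret C: Metric_space "mspace ?m" "mdist ?m" by (rule Metric_space_mspace_mdist)
  have top: "mtopology_of ?m = C.mtopology"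
    by (simp add: mtopology_of_def)
  have ms: "f \<in> mspace ?m \<longleftrightarrow> f \<in> extensional (topspace X) \<and>
      continuous_map X euclideanreal f \<and> bounded (f ` topspace X)" for f
    by (auto simp: Met_TC.mbounded_alt bounded_two_points)
  let ?t = "\<lambda>g. translate X a g f"
  show ?thesis
  proof
    assume f: "f \<in> RUC X a"
    then have fm: "f \<in> mspace ?m" and c: "continuous_map euclidean C.mtopology ?t"
      by (auto simp: RUC_def top simp del: mspace_cfunspace)
    have tm: "?t g \<in> mspace ?m" for g
      using funcset_mem[OF continuous_map_funspace[OF c], of g] by (simp del: mspace_cfunspace)
    have "uniform_limit (topspace X) (\<lambda>g x. f (a g x)) f (nhds 0)"
    proof (rule uniform_limitI)
      fix e :: real assume "e > 0"
      then obtain U where U: "open U" "0 \<in> U" "\<And>g. g \<in> U \<Longrightarrow> mdist ?m (?t 0) (?t g) < e / 2"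
        using c[unfolded C.continuous_map_to_metric, rule_format, of 0 "e / 2"]
        by (auto simp del: mspace_cfunspace)
      have "dist (f (a g x)) (f x) < e" if "g \<in> U" "x \<in> topspace X" for g x
        using mdist_cfunspace_imp_mdist_le[OF tm[of 0] tm[of g] less_imp_le[OF U(3)[OF that(1)]] that(2)]
          \<open>e > 0\<close> that(2) by (simp add: translate_def action_zero dist_commute)
      then show "\<forall>\<^sub>F g in nhds 0. \<forall>x\<in>topspace X. dist (f (a g x)) (f x) < e"
        using U(1,2) unfolding eventually_nhds by blast
    qed
    with fm show ?R by (simp add: ms del: mspace_cfunspace)
  next
    assume R: ?R
    have tm: "?t g \<in> mspace ?m" for g
    proof -
      have "continuous_map X euclideanreal (\<lambda>x. f (a g x))"
        using R continuous_map_compose[OF continuous_translation] by (auto simp: o_def)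
      then have "continuous_map X euclideanreal (?t g)"
        by (rule continuous_map_eq) (simp add: translate_def)
      moreover have "?t g ` topspace X \<subseteq> f ` topspace X"
        using action_closed by (auto simp: translate_def)
      ultimately show ?thesis
        using R bounded_subset by (auto simp: ms translate_def simp del: mspace_cfunspace)
    qed
    have "continuous_map euclidean C.mtopology ?t"
      unfolding C.continuous_map_to_metric
    proof (intro ballI allI impI)
      fix g and e :: real assume "e > 0"
      have "\<forall>\<^sub>F h in nhds g. \<forall>x\<in>topspace X. dist (f (a h x)) (f (a g x)) < e / 2"
        using uniform_limitD[OF uniform_limit_translates half_gt_zero[OF \<open>e > 0\<close>]] R by blast
      then obtain U where U: "open U" "g \<in> U"
          "\<And>h x. h \<in> U \<Longrightarrow> x \<in> topspace X \<Longrightarrow> dist (f (a h x)) (f (a g x)) < e / 2"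
        unfolding eventually_nhds by blast
      have "mdist ?m (?t g) (?t h) < e" if "h \<in> U" for h
      proof -
        have "mdist ?m (?t g) (?t h) \<le> e / 2"
        proof (rule mdist_cfunspace_le)
          show "0 \<le> e / 2" using \<open>e > 0\<close> by simp
          fix x assume x: "x \<in> topspace X"
          show "mdist euclidean_metric (?t g x) (?t h x) \<le> e / 2"
            using U(3)[OF that x] x by (simp add: translate_def dist_commute)
        qed
        then show ?thesis using \<open>e > 0\<close> by simp
      qed
      then show "\<exists>U. openin euclidean U \<and> g \<in> U \<and> (\<forall>h\<in>U. ?t h \<in> C.mball (?t g) e)"
        using U(1,2) tm by (intro exI[of _ U]) (simp del: mspace_cfunspace)
    qed
    then show "f \<in> RUC X a"
      using R by (simp add: RUC_def ms top del: mspace_cfunspace)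
  qed
qed

text \<open>
  For \<open>e > 0\<close>, the pairs \<open>(g, x)\<close> for which \<open>F (a g x)\<close> and \<open>F x\<close> are at least \<open>e\<close> apart form a closed set, whose
  projection to the group is closed because \<open>X\<close> is compact, and misses the identity.
\<close>

lemma continuous_imp_uniform_limit_translates:
  assumes "compact_space X" and F: "continuous_map X euclideanreal F"
  shows "uniform_limit (topspace X) (\<lambda>g x. F (a g x)) F (nhds 0)"
proof (rule uniform_limitI)
  fix e :: real assume e: "e > 0"
  let ?P = "prod_topology (euclidean :: 'g topology) X"
  have "continuous_map ?P euclideanreal (\<lambda>z. F (a (fst z) (snd z)))"
    using continuous_map_compose[OF continuous_action F] by (simp add: o_def case_prod_unfold)
  moreover have "continuous_map ?P euclideanreal (\<lambda>z. F (snd z))"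
    using continuous_map_compose[OF continuous_map_snd F] by (simp add: o_def)
  ultimately have "continuous_map ?P euclideanreal (\<lambda>z. F (a (fst z) (snd z)) - F (snd z))"
    by (rule continuous_map_diff)
  moreover have "closedin euclideanreal (- ball 0 e)"
    by (simp only: closed_closedin[symmetric] closed_Compl open_ball)
  ultimately have "closedin ?P {z \<in> topspace ?P. F (a (fst z) (snd z)) - F (snd z) \<in> - ball 0 e}"
      (is "closedin ?P ?C")
    by (rule closedin_continuous_map_preimage)
  then have cl: "closed (fst ` ?C)"
    using Abstract_Topological_Spaces.closed_map_fst[OF assms(1), of "euclidean :: 'g topology"]
    by (metis (no_types, lifting) closed_closedin closed_map_def)
  have "0 \<notin> fst ` ?C"
    using e by (auto simp: action_zero)
  moreover have "dist (F (a g x)) (F x) < e" if "g \<notin> fst ` ?C" "x \<in> topspace X" for g x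
  proof (rule ccontr)
    assume "\<not> ?thesis"
    then have "(g, x) \<in> ?C" using that(2) by (simp add: dist_real_def)
    then show False using that(1) by (metis (no_types, lifting) fst_conv imageI)
  qed
  ultimately show "\<forall>\<^sub>F g in nhds 0. \<forall>x\<in>topspace X. dist (F (a g x)) (F x) < e"
    unfolding eventually_nhds using cl by (intro exI[of _ "- fst ` ?C"]) auto
qed

lemma continuous_imp_restrict_RUC:
  assumes "compact_space X" and F: "continuous_map X euclideanreal F"
  shows "restrict F (topspace X) \<in> RUC X a"
proof -
  have "compactin euclideanreal (F ` topspace X)"
    using assms image_compactin unfolding compact_space_def by blast
  then have "bounded (F ` topspace X)"
    by (simp add: compact_imp_bounded)
  moreover have "continuous_map X euclideanreal (restrict F (topspace X))"
    using F by (rule continuous_map_eq) simp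
  moreover have "uniform_limit (topspace X) (\<lambda>g x. restrict F (topspace X) (a g x))
      (restrict F (topspace X)) (nhds 0)"
    by (rule uniform_limit_cong[THEN iffD1, rotated -1,
          OF continuous_imp_uniform_limit_translates[OF assms]])
      (auto simp: action_closed)
  ultimately show ?thesis
    by (simp add: RUC_iff)
qed

end

lemma G_space_imp_continuous_action: "G_space X a \<Longrightarrow> continuous_action X a"
  by unfold_locales (auto simp: G_space_def)

lemma continuous_on_uminus_group: "continuous_on UNIV (uminus :: 'g \<Rightarrow> 'g::topological_group_add)"
  unfolding continuous_on_def by (auto intro: tendsto_intros)

text \<open>
  Inversion turns a covering by left translates of \<open>- U\<close> into one by right translates of \<open>U\<close>. Right
  translates are what is needed below, since the functions in \<open>RUC\<close> are uniformly continuous with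
  respect to perturbing the group element on the left.
\<close>

lemma uniformly_Lindelof_right_translates:
  fixes U :: "'g::topological_group_add set"
  assumes "uniformly_Lindelof TYPE('g)" "open U" "0 \<in> U"
  obtains C where "countable C" "\<And>g. \<exists>c\<in>C. \<exists>u\<in>U. g = u + c"
proof -
  have "open (uminus -` U)"
    by (rule open_vimage[OF assms(2) continuous_on_uminus_group])
  then have "0 \<in> interior (uminus -` U)"
    using assms(3) by (simp add: interior_open)
  with assms(1) have "\<exists>C. countable C \<and> UNIV = {c + u | c u. c \<in> C \<and> u \<in> uminus -` U}"
    unfolding uniformly_Lindelof_def by (elim allE impE)
  then obtain C where C: "countable C" "UNIV = {c + u | c u. c \<in> C \<and> u \<in> uminus -` U}"
    by (elim exE conjE)
  show ?thesis
  proof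
    show "countable (uminus ` C)" using C(1) by simp
    fix g
    obtain c u where "- g = c + u" "c \<in> C" "- u \<in> U"
      using C(2)[symmetric, THEN eqset_imp_iff, of "- g"] by auto
    then show "\<exists>c\<in>uminus ` C. \<exists>u\<in>U. g = u + c"
      by (metis image_eqI minus_add minus_minus)
  qed
qed

definition shift_action :: "'g::topological_group_add \<Rightarrow> ('g \<Rightarrow> real) \<Rightarrow> 'g \<Rightarrow> real" where
  "shift_action g \<omega> = (\<lambda>h. \<omega> (h + g))"

section \<open>Closures of orbit functions\<close>

text \<open>
  The inequalities between the values of an orbit function that follow from \<open>f \<in> RUC X a\<close> are closed
  conditions, hence hold throughout \<open>X\<^sub>f\<close>. The space \<open>X\<^sub>f\<close> is therefore a compact set of functions that
  are uniformly continuous with a common modulus.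
\<close>

locale RUC_orbit = continuous_action X a
  for X :: "'x topology" and a :: "'g::topological_group_add \<Rightarrow> 'x \<Rightarrow> 'x" +
  fixes f :: "'x \<Rightarrow> real"
  assumes RUC: "f \<in> RUC X a"
begin

abbreviation X\<^sub>f where "X\<^sub>f \<equiv> orbit_closure_system X a f"

lemma orbit_function_in_cube: "orbit_function a f ` topspace X \<subseteq> topspace (orbit_cube X f)"
proof -
  have "\<bar>f x\<bar> \<le> sup_norm X f" if "x \<in> topspace X" for x
  proof -
    obtain B where "\<And>x. x \<in> topspace X \<Longrightarrow> \<bar>f x\<bar> \<le> B"
      using RUC by (auto simp: RUC_iff bounded_iff)
    then have "bdd_above ((\<lambda>x. \<bar>f x\<bar>) ` topspace X)" by (auto intro!: bdd_aboveI2)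
    from cSUP_upper[OF that this] show ?thesis by (simp add: sup_norm_def)
  qed
  then have "f (a g x) \<in> {- sup_norm X f .. sup_norm X f}" if "x \<in> topspace X" for g x
    using action_closed[OF that, of g] by (fastforce simp: abs_le_iff)
  then show ?thesis
    by (auto simp: orbit_cube_def orbit_function_def)
qed

lemma topspace_orbit_closure:
  "topspace X\<^sub>f = orbit_cube X f closure_of (orbit_function a f ` topspace X)"
  unfolding orbit_closure_system_def
  by (simp add: topspace_subtopology Int_absorb1 closure_of_subset_topspace)

lemma orbit_function_in_orbit_closure: "orbit_function a f ` topspace X \<subseteq> topspace X\<^sub>f"
  unfolding topspace_orbit_closure by (rule closure_of_subset[OF orbit_function_in_cube])

lemma orbit_closure_minimal:
  assumes "closedin (orbit_cube X f) S" "orbit_function a f ` topspace X \<subseteq> S"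
  shows "topspace X\<^sub>f \<subseteq> S"
  unfolding topspace_orbit_closure using assms by (rule closure_of_minimal[rotated])

lemma continuous_map_cube_eval: "continuous_map (orbit_cube X f) euclideanreal (\<lambda>\<omega>. \<omega> h)"
proof -
  have "continuous_map (orbit_cube X f) (subtopology euclideanreal {- sup_norm X f .. sup_norm X f})
      (\<lambda>\<omega>. \<omega> h)"
    unfolding orbit_cube_def by (rule continuous_map_product_projection) simp
  then show ?thesis by (rule continuous_map_into_fulltopology)
qed

lemma continuous_map_orbit_closure_eval: "continuous_map X\<^sub>f euclideanreal (\<lambda>\<omega>. \<omega> h)"
  unfolding orbit_closure_system_def
  by (rule continuous_map_from_subtopology[OF continuous_map_cube_eval])

lemma compact_orbit_closure: "compact_space X\<^sub>f"
proof -
  have "compact_space (orbit_cube X f)"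
    unfolding orbit_cube_def
    by (auto simp: compact_space_product_topology compact_space_subtopology)
  then show ?thesis
    unfolding orbit_closure_system_def
    by (intro compact_space_subtopology closedin_compact_space) auto
qed

lemma Hausdorff_orbit_closure: "Hausdorff_space X\<^sub>f"
  unfolding orbit_closure_system_def orbit_cube_def
  by (intro Hausdorff_space_subtopology) (auto simp: Hausdorff_space_product_topology Hausdorff_space_subtopology)

lemma uniform_limit_orbit_closure:
  "uniform_limit (topspace X\<^sub>f \<times> UNIV) (\<lambda>u (\<omega>, h). \<omega> (u + h)) (\<lambda>(\<omega>, h). \<omega> h) (nhds 0)"
proof (rule uniform_limitI)
  fix e :: real assume "e > 0"
  have "\<forall>\<^sub>F u in nhds 0. \<forall>x\<in>topspace X. dist (f (a u x)) (f x) < e / 2"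
    using RUC \<open>e > 0\<close> by (intro uniform_limitD) (auto simp: RUC_iff)
  then show "\<forall>\<^sub>F u in nhds 0. \<forall>z\<in>topspace X\<^sub>f \<times> UNIV.
      dist (case z of (\<omega>, h) \<Rightarrow> \<omega> (u + h)) (case z of (\<omega>, h) \<Rightarrow> \<omega> h) < e"
  proof eventually_elim
    case (elim u)
    have "\<bar>\<omega> (u + h) - \<omega> h\<bar> \<le> e / 2" if "\<omega> \<in> topspace X\<^sub>f" for \<omega> h
    proof -
      let ?S = "{\<omega> \<in> topspace (orbit_cube X f). \<omega> (u + h) - \<omega> h \<in> cball 0 (e / 2)}"
      have "closedin (orbit_cube X f) ?S"
        by (rule closedin_continuous_map_preimage[OF
              continuous_map_diff[OF continuous_map_cube_eval continuous_map_cube_eval]]) simp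
      moreover have "orbit_function a f ` topspace X \<subseteq> ?S"
      proof (rule image_subsetI)
        fix x assume x: "x \<in> topspace X"
        then have "dist (f (a u (a h x))) (f (a h x)) < e / 2"
          using elim action_closed by blast
        then show "orbit_function a f x \<in> ?S"
          using orbit_function_in_cube x
          by (auto simp: orbit_function_def action_add dist_real_def abs_minus_commute)
      qed
      ultimately show ?thesis
        using orbit_closure_minimal that by fastforce
    qed
    then have "\<bar>\<omega> (u + h) - \<omega> h\<bar> < e" if "\<omega> \<in> topspace X\<^sub>f" for \<omega> h
      using that \<open>e > 0\<close> by (fastforce intro: le_less_trans[where y = "e / 2"])
    then show ?case
      by (auto simp: dist_real_def)
  qed
qed

lemma shift_orbit_function:
  "x \<in> topspace X \<Longrightarrow> shift_action g (orbit_function a f x) = orbit_function a f (a g x)"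
  by (simp add: shift_action_def orbit_function_def action_add)

lemma shift_closed:
  assumes "\<omega> \<in> topspace X\<^sub>f"
  shows "shift_action g \<omega> \<in> topspace X\<^sub>f"
proof -
  have cont: "continuous_map (orbit_cube X f) (orbit_cube X f) (shift_action g)"
    unfolding orbit_cube_def shift_action_def
    by (intro continuous_map_componentwise_UNIV[THEN iffD2] allI continuous_map_product_projection) simp
  have "closedin (orbit_cube X f) (topspace X\<^sub>f)"
    unfolding topspace_orbit_closure by simp
  from closedin_continuous_map_preimage[OF cont this]
  have "topspace X\<^sub>f \<subseteq> {\<omega> \<in> topspace (orbit_cube X f). shift_action g \<omega> \<in> topspace X\<^sub>f}"
  proof (rule orbit_closure_minimal)
    show "orbit_function a f ` topspace X
      \<subseteq> {\<omega> \<in> topspace (orbit_cube X f). shift_action g \<omega> \<in> topspace X\<^sub>f}"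
      using orbit_function_in_cube orbit_function_in_orbit_closure action_closed
      by (auto simp: shift_orbit_function)
  qed
  then show ?thesis using assms by blast
qed

lemma continuous_map_into_orbit_closure:
  assumes "\<And>h. continuous_map Z euclideanreal (\<lambda>z. k z h)" "k \<in> topspace Z \<rightarrow> topspace X\<^sub>f"
  shows "continuous_map Z X\<^sub>f k"
proof -
  have k: "k z \<in> topspace (orbit_cube X f)" if "z \<in> topspace Z" for z
    using that assms(2) unfolding orbit_closure_system_def by auto
  then have "continuous_map Z (orbit_cube X f) k"
    using assms(1) unfolding orbit_cube_def
    by (fastforce simp: continuous_map_componentwise_UNIV continuous_map_in_subtopology)
  then show ?thesis
    using assms(2) unfolding orbit_closure_system_def
    by (auto simp: continuous_map_in_subtopology)
qed

text \<open>
  The elements \<open>h + g\<close> and \<open>h + g'\<close> differ on the left by \<open>h + g' - (h + g)\<close>, which tends to \<open>0\<close> as \<open>g'\<close>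
  tends to \<open>g\<close>, for fixed \<open>h\<close>. With the common modulus, \<open>\<omega> (h + g)\<close> is continuous in \<open>g\<close> uniformly over
  \<open>\<omega>\<close>.
\<close>

lemma continuous_shift_eval:
  "continuous_map (prod_topology euclidean X\<^sub>f) euclideanreal (\<lambda>z. snd z (h + fst z))"
proof (rule continuous_map_joint[where p = "\<lambda>g \<omega>. \<omega> (h + g)"])
  fix g :: 'g
  show "continuous_map X\<^sub>f euclideanreal (\<lambda>\<omega>. \<omega> (h + g))"
    by (rule continuous_map_orbit_closure_eval)
  have "((\<lambda>k. h + k - (h + g)) \<longlongrightarrow> h + g - (h + g)) (nhds g)"
    by (intro tendsto_intros filterlim_ident)
  then have "filterlim (\<lambda>k. h + k - (h + g)) (nhds 0) (nhds g)"
    by simp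
  from uniform_limit_compose'[OF filterlim_compose[OF uniform_limit_orbit_closure this],
      of "\<lambda>\<omega>. (\<omega>, h + g)" "topspace X\<^sub>f"]
  show "uniform_limit (topspace X\<^sub>f) (\<lambda>g \<omega>. \<omega> (h + g)) (\<lambda>\<omega>. \<omega> (h + g)) (nhds g)"
    by simp
qed

lemma compact_G_system_orbit_closure: "compact_G_system X\<^sub>f shift_action"
proof -
  have "continuous_map (prod_topology euclidean X\<^sub>f) X\<^sub>f (\<lambda>z. shift_action (fst z) (snd z))"
  proof (rule continuous_map_into_orbit_closure)
    fix h
    show "continuous_map (prod_topology euclidean X\<^sub>f) euclideanreal
        (\<lambda>z. shift_action (fst z) (snd z) h)"
      unfolding shift_action_def by (rule continuous_shift_eval)
  qed (auto intro: shift_closed)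
  moreover have "completely_regular_space X\<^sub>f"
    by (rule compact_Hausdorff_imp_completely_regular_space[OF compact_orbit_closure Hausdorff_orbit_closure])
  ultimately show ?thesis
    using compact_orbit_closure Hausdorff_orbit_closure
    by (auto simp: compact_G_system_def G_space_def case_prod_unfold shift_action_def add.assoc)
qed

lemma continuous_orbit_function: "continuous_map X X\<^sub>f (orbit_function a f)"
proof (rule continuous_map_into_orbit_closure)
  fix h
  show "continuous_map X euclideanreal (\<lambda>x. orbit_function a f x h)"
    using RUC continuous_map_compose[OF continuous_translation]
    by (auto simp: RUC_iff orbit_function_def o_def)
qed (use orbit_function_in_orbit_closure in auto)

text \<open>
  The translate of \<open>f\<close> by \<open>g\<close> is evaluation at \<open>g\<close> composed with the orbit function map, and the
  evaluations form a family of continuous functions on the compact metrizable space \<open>X\<^sub>f\<close>.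
\<close>

lemma metrizable_orbit_closure_imp_orbit_separable:
  assumes "metrizable_space X\<^sub>f"
  shows "orbit_separable X a f"
  unfolding orbit_separable_def
proof (intro allI impI)
  fix e :: real assume "e > 0"
  have sc: "second_countable X\<^sub>f"
    by (rule compact_metrizable_imp_second_countable[OF compact_orbit_closure assms])
  obtain C where C: "countable C" "\<forall>g. \<exists>c\<in>C. \<forall>\<omega>\<in>topspace X\<^sub>f. \<bar>\<omega> g - \<omega> c\<bar> < e"
    using countable_uniform_net[where p = "\<lambda>h \<omega>. \<omega> h",
        OF compact_orbit_closure sc continuous_map_orbit_closure_eval \<open>e > 0\<close>]
    by (elim exE conjE)
  have "\<exists>c\<in>C. \<forall>x\<in>topspace X. \<bar>f (a g x) - f (a c x)\<bar> < e" for g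
  proof -
    obtain c where c: "c \<in> C" "\<And>\<omega>. \<omega> \<in> topspace X\<^sub>f \<Longrightarrow> \<bar>\<omega> g - \<omega> c\<bar> < e"
      using C(2) by blast
    have "\<bar>orbit_function a f x g - orbit_function a f x c\<bar> < e" if "x \<in> topspace X" for x
      using c(2) orbit_function_in_orbit_closure that by blast
    with c(1) show ?thesis by (auto simp: orbit_function_def)
  qed
  with C(1) show "\<exists>C. countable C \<and> (\<forall>g. \<exists>c\<in>C. \<forall>x\<in>topspace X. \<bar>f (a g x) - f (a c x)\<bar> < e)"
    by blast
qed

text \<open>
  Countably many right translates of each neighborhood of the identity cover the group. So, by the
  common modulus, the elements of \<open>X\<^sub>f\<close> are determined by their values on one countable set \<open>D\<close>, and
  compactness makes the restriction to \<open>D\<close> an embedding into a countable power of the real line.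
\<close>

lemma uniformly_Lindelof_imp_metrizable_orbit_closure:
  assumes "uniformly_Lindelof TYPE('g)"
  shows "metrizable_space X\<^sub>f"
proof -
  have "\<exists>C. countable C \<and> (\<forall>h. \<exists>c\<in>C. \<forall>\<omega>\<in>topspace X\<^sub>f. \<bar>\<omega> h - \<omega> c\<bar> < e)" if e: "e > 0" for e :: real
  proof -
    from uniform_limitD[OF uniform_limit_orbit_closure that]
    obtain U where U: "open U" "0 \<in> U"
        "\<And>u \<omega> h. u \<in> U \<Longrightarrow> \<omega> \<in> topspace X\<^sub>f \<Longrightarrow> \<bar>\<omega> (u + h) - \<omega> h\<bar> < e"
      by (force simp: eventually_nhds dist_real_def)
    obtain C where "countable C" "\<forall>g. \<exists>c\<in>C. \<exists>u\<in>U. g = u + c"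
      using uniformly_Lindelof_right_translates[OF assms U(1,2)] by metis
    then show ?thesis
      using U(3) by metis
  qed
  then have "\<exists>C. countable C \<and> (\<forall>h. \<exists>c\<in>C. \<forall>\<omega>\<in>topspace X\<^sub>f. \<bar>\<omega> h - \<omega> c\<bar> < inverse (real (Suc n)))" for n
    by simp
  then obtain C where C: "\<And>n. countable (C n)"
      "\<And>n h. \<exists>c\<in>C n. \<forall>\<omega>\<in>topspace X\<^sub>f. \<bar>\<omega> h - \<omega> c\<bar> < inverse (real (Suc n))"
    by metis
  define D where "D = (\<Union>n. C n)"
  let ?P = "product_topology (\<lambda>_. euclideanreal) D"
  have "continuous_map X\<^sub>f ?P (\<lambda>\<omega>. restrict \<omega> D)"
    using continuous_map_orbit_closure_eval by (auto simp: continuous_map_componentwise)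
  moreover have "inj_on (\<lambda>\<omega>. restrict \<omega> D) (topspace X\<^sub>f)"
  proof (rule inj_onI, rule ext, rule ccontr)
    fix \<omega> \<omega>' h
    assume w: "\<omega> \<in> topspace X\<^sub>f" "\<omega>' \<in> topspace X\<^sub>f" and eq: "restrict \<omega> D = restrict \<omega>' D"
      and ne: "\<omega> h \<noteq> \<omega>' h"
    then obtain n where n: "inverse (real (Suc n)) < \<bar>\<omega> h - \<omega>' h\<bar> / 2"
      using reals_Archimedean[of "\<bar>\<omega> h - \<omega>' h\<bar> / 2"] by auto
    obtain c where c: "c \<in> C n" "\<bar>\<omega> h - \<omega> c\<bar> < inverse (real (Suc n))"
        "\<bar>\<omega>' h - \<omega>' c\<bar> < inverse (real (Suc n))"
      using C(2) w by blast
    have "c \<in> D" using c(1) unfolding D_def by blast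
    then have "\<omega> c = \<omega>' c"
      using fun_cong[OF eq, of c] by simp
    then show False using c n by argo
  qed
  ultimately have "embedding_map X\<^sub>f ?P (\<lambda>\<omega>. restrict \<omega> D)"
    by (intro T1_Spaces.continuous_imp_embedding_map compact_orbit_closure)
      (auto simp: Hausdorff_space_product_topology)
  moreover have "metrizable_space ?P"
  proof -
    have "countable D" using C(1) by (simp add: D_def)
    then show ?thesis
      unfolding metrizable_space_product_topology
      by (auto simp: metrizable_space_euclidean intro: countable_subset[of _ D])
  qed
  ultimately show ?thesis
    using embedding_map_imp_homeomorphic_space homeomorphic_metrizable_space
      metrizable_space_subtopology by blast
qed

end

text \<open>
  The systems \<open>X\<^sub>f\<close> for \<open>f \<in> RUC X a\<close> are metrizable, and the orbit functions map \<open>X\<close> equivariantly to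
  their product. On a compact system every continuous function is in \<open>RUC\<close>, so the map separates
  points: the value of the orbit function of \<open>f\<close> at the identity is \<open>f\<close>.
\<close>

lemma uniformly_Lindelof_imp_m_approximable:
  fixes X :: "'x topology" and a :: "'g::topological_group_add \<Rightarrow> 'x \<Rightarrow> 'x"
  assumes uL: "uniformly_Lindelof TYPE('g)" and X: "compact_G_system X a"
  shows "m_approximable X a"
proof -
  interpret continuous_action X a
    using X by (simp add: compact_G_system_def G_space_imp_continuous_action)
  have comp: "compact_space X" and haus: "Hausdorff_space X" and creg: "completely_regular_space X"
    using X by (auto simp: compact_G_system_def G_space_def)
  have R: "RUC_orbit X a f" if "f \<in> RUC X a" for f
    using that by unfold_locales
  let ?Y = "orbit_closure_system X a :: _ \<Rightarrow> ('g \<Rightarrow> real) topology" and ?b = "\<lambda>f. shift_action"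
  let ?P = "product_topology ?Y (RUC X a)"
  define h where "h x = (\<lambda>f\<in>RUC X a. orbit_function a f x)" for x
  have cont: "continuous_map X ?P h"
    using RUC_orbit.continuous_orbit_function[OF R]
    by (auto simp: continuous_map_componentwise h_def)
  have "Hausdorff_space ?P"
    using RUC_orbit.Hausdorff_orbit_closure[OF R] by (auto simp: Hausdorff_space_product_topology)
  note closed = T1_Spaces.continuous_imp_closed_map[OF cont comp this]
  have "inj_on h (topspace X)"
  proof (rule inj_onI, rule ccontr)
    fix x y assume xy: "x \<in> topspace X" "y \<in> topspace X" "h x = h y" "x \<noteq> y"
    have "closedin X {y}"
      using xy(2) haus by (simp add: closedin_Hausdorff_singleton)
    moreover have "x \<in> topspace X - {y}"
      using xy by simp
    ultimately obtain F where "continuous_map X (top_of_set {0..1::real}) F" "F x = 0" "F y = 1"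
      using creg unfolding completely_regular_space_def by (metis image_subset_iff singletonD singletonI)
    then have F: "continuous_map X euclideanreal F" "F x \<noteq> F y"
      by (auto simp: continuous_map_in_subtopology)
    let ?F = "restrict F (topspace X)"
    have "orbit_function a ?F x = orbit_function a ?F y"
      using fun_cong[OF xy(3), of ?F] continuous_imp_restrict_RUC[OF comp F(1)] by (simp add: h_def)
    from fun_cong[OF this, of 0] show False
      using F(2) xy(1,2) by (simp add: orbit_function_def action_zero)
  qed
  then have emb: "homeomorphic_map X (subtopology ?P (h ` topspace X)) h"
    using injective_closed_imp_embedding_map[OF cont closed] by (simp add: embedding_map_def)
  have eqv: "h (a g x) = product_action (RUC X a) ?b g (h x)" if "x \<in> topspace X" for g x
    unfolding h_def product_action_def
    using RUC_orbit.shift_orbit_function[OF R that] by (auto intro!: restrict_ext)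
  have "product_action (RUC X a) ?b g z \<in> h ` topspace X" if "z \<in> h ` topspace X" for g z
    using that eqv action_closed by (metis (no_types, lifting) imageE imageI)
  moreover have "closedin ?P (h ` topspace X)"
    using closed by (simp add: closed_map_def)
  ultimately have "embeds_in_metrizable_product X a (RUC X a) ?Y ?b"
    unfolding embeds_in_metrizable_product_def G_subsystem_def G_isomorphism_def
    using RUC_orbit.compact_G_system_orbit_closure[OF R] emb eqv
      RUC_orbit.uniformly_Lindelof_imp_metrizable_orbit_closure[OF R uL] by blast
  then show ?thesis
    by (rule m_approximableI[OF X])
qed

section \<open>Uniformly continuous bump functions on a topological group\<close>

text \<open>
  Cut at the first element with which the partial sums reach half of \<open>T\<close>, or at the last element if
  they never do.
\<close>

lemma sum_list_split_halves:
  fixes w :: "'b \<Rightarrow> real"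
  assumes "l \<noteq> []" "T > 0" "sum_list (map w l) < T"
  obtains ys z zs where "l = ys @ z # zs" "sum_list (map w ys) < T / 2" "sum_list (map w zs) < T / 2"
proof -
  have "\<exists>ys z zs. l = ys @ z # zs \<and> sum_list (map w ys) < T / 2 \<and>
      (zs = [] \<or> sum_list (map w ys) + w z \<ge> T / 2)"
    using assms(1)
  proof (induction l rule: rev_induct)
    case (snoc x l)
    show ?case
    proof (cases "sum_list (map w l) < T / 2")
      case True
      then show ?thesis by (intro exI[of _ l] exI[of _ x] exI[of _ "[]"]) simp
    next
      case False
      then have "l \<noteq> []" using assms(2) by auto
      from snoc.IH[OF this] obtain ys z zs where *: "l = ys @ z # zs" "sum_list (map w ys) < T / 2"
          "zs = [] \<or> sum_list (map w ys) + w z \<ge> T / 2"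
        by blast
      have "sum_list (map w ys) + w z \<ge> T / 2"
        using * False by auto
      then show ?thesis
        using * by (intro exI[of _ ys] exI[of _ z] exI[of _ "zs @ [x]"]) simp
    qed
  qed simp
  then obtain ys z zs where *: "l = ys @ z # zs" "sum_list (map w ys) < T / 2"
      "zs = [] \<or> sum_list (map w ys) + w z \<ge> T / 2"
    by blast
  then have "sum_list (map w zs) < T / 2"
    using assms(2,3) by auto
  with * that show ?thesis by blast
qed

text \<open>
  The setting of the Birkhoff-Kakutani construction. Starting with the whole group at level \<open>0\<close>
  ensures that every element can be decomposed, so that no infimum below is over the empty set.
\<close>

locale neighbourhood_chain =
  fixes V :: "nat \<Rightarrow> 'g::topological_group_add set"
  assumes V_UNIV: "V 0 = UNIV"
    and V_open: "open (V n)" and V_zero: "0 \<in> V n" and V_minus: "x \<in> V n \<Longrightarrow> - x \<in> V n"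
    and V_triple: "x \<in> V (Suc n) \<Longrightarrow> y \<in> V (Suc n) \<Longrightarrow> z \<in> V (Suc n) \<Longrightarrow> x + y + z \<in> V n"
begin

text \<open>
  A pair \<open>(v, n)\<close> stands for a summand \<open>v \<in> V n\<close> of cost \<open>(1 / 2) ^ n\<close>. The seminorm of an element is
  the infimum of the costs of writing it as a sum. It is subadditive by construction.
\<close>

definition decomposition :: "('g \<times> nat) list \<Rightarrow> bool" where
  "decomposition l \<longleftrightarrow> (\<forall>p\<in>set l. fst p \<in> V (snd p))"

definition total :: "('g \<times> nat) list \<Rightarrow> 'g" where
  "total l = sum_list (map fst l)"

definition weight :: "('g \<times> nat) list \<Rightarrow> real" where
  "weight l = sum_list (map (\<lambda>p. (1 / 2) ^ snd p) l)"

definition seminorm :: "'g \<Rightarrow> real" where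
  "seminorm x = Inf {weight l | l. decomposition l \<and> total l = x}"

lemma V_antimono: "m \<le> n \<Longrightarrow> V n \<subseteq> V m"
proof (induction n rule: dec_induct)
  case (step n)
  then show ?case using V_triple[of _ n 0 0] V_zero by auto
qed simp

lemma weight_nonneg: "weight l \<ge> 0"
  unfolding weight_def by (rule sum_list_nonneg) auto

text \<open>
  This keeps the seminorm from collapsing, and it is why the neighborhoods must absorb sums of three
  elements: a decomposition of cost below \<open>(1 / 2) ^ k\<close> consists of two shorter ones, of cost below
  half of this, around a single summand, which lies in \<open>V (Suc k)\<close>.
\<close>

lemma total_mem_if_weight_less:
  "decomposition l \<Longrightarrow> weight l < (1 / 2) ^ k \<Longrightarrow> total l \<in> V k"
proof (induction l arbitrary: k rule: length_induct)
  case (1 l)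
  show ?case
  proof (cases "l = []")
    case True
    then show ?thesis by (simp add: total_def V_zero)
  next
    case False
    have "sum_list (map (\<lambda>p. (1 / 2) ^ snd p) l) < (1 / 2 :: real) ^ k"
      using 1(3) by (simp add: weight_def)
    from sum_list_split_halves[OF False _ this]
    obtain ys z zs where l: "l = ys @ z # zs" and
      "weight ys < (1 / 2) ^ k / 2" "weight zs < (1 / 2) ^ k / 2"
      unfolding weight_def by (metis half_gt_zero_iff zero_less_one zero_less_power)
    then have less: "weight ys < (1 / 2) ^ Suc k" "weight zs < (1 / 2) ^ Suc k"
      by simp_all
    have "total ys \<in> V (Suc k)" "total zs \<in> V (Suc k)"
      using 1(1,2) less l by (auto simp: decomposition_def)
    moreover have "fst z \<in> V (Suc k)"
    proof -
      have "weight l = weight ys + (1 / 2) ^ snd z + weight zs"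
        by (simp add: l weight_def)
      then have "(1 / 2 :: real) ^ snd z < (1 / 2) ^ k"
        using 1(3) weight_nonneg[of ys] weight_nonneg[of zs] by linarith
      then have "Suc k \<le> snd z"
        by (simp add: power_strict_decreasing_iff)
      then show ?thesis
        using V_antimono 1(2) by (auto simp: decomposition_def l)
    qed
    ultimately show ?thesis
      using V_triple by (simp add: l total_def add.assoc)
  qed
qed

lemma bdd_below_weights: "bdd_below {weight l | l. decomposition l \<and> total l = x}"
  using weight_nonneg by (auto intro!: bdd_belowI[of _ 0])

lemma seminorm_le_weight: "decomposition l \<Longrightarrow> seminorm (total l) \<le> weight l"
  unfolding seminorm_def by (rule cInf_lower[OF _ bdd_below_weights]) auto

lemma seminorm_less_iff: "seminorm x < r \<longleftrightarrow> (\<exists>l. decomposition l \<and> total l = x \<and> weight l < r)"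
proof -
  have "decomposition [(x, 0)]" "total [(x, 0)] = x"
    by (auto simp: decomposition_def total_def V_UNIV)
  then have "{weight l | l. decomposition l \<and> total l = x} \<noteq> {}" by blast
  from cInf_less_iff[OF this bdd_below_weights] show ?thesis
    unfolding seminorm_def by blast
qed

lemma seminorm_nonneg: "seminorm x \<ge> 0"
  using seminorm_less_iff[of x 0] weight_nonneg by (meson not_less)

lemma seminorm_add_le: "seminorm (x + y) \<le> seminorm x + seminorm y"
proof (rule field_le_epsilon)
  fix e :: real assume "e > 0"
  then obtain l m where l: "decomposition l" "total l = x" "weight l < seminorm x + e / 2"
      and m: "decomposition m" "total m = y" "weight m < seminorm y + e / 2"
    using seminorm_less_iff[of x "seminorm x + e / 2"] seminorm_less_iff[of y "seminorm y + e / 2"] by auto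
  have "decomposition (l @ m)" "total (l @ m) = x + y" "weight (l @ m) = weight l + weight m"
    using l m by (auto simp: decomposition_def total_def weight_def)
  then have "seminorm (x + y) \<le> weight l + weight m"
    using seminorm_le_weight[of "l @ m"] by simp
  then show "seminorm (x + y) \<le> seminorm x + seminorm y + e"
    using l(3) m(3) by argo
qed

lemma seminorm_le_power: "u \<in> V n \<Longrightarrow> seminorm u \<le> (1 / 2) ^ n"
  using seminorm_le_weight[of "[(u, n)]"] by (simp add: decomposition_def total_def weight_def)

lemma seminorm_add_diff_le:
  assumes "u \<in> V n"
  shows "\<bar>seminorm (u + x) - seminorm x\<bar> \<le> (1 / 2) ^ n"
  using seminorm_add_le[of u x] seminorm_add_le[of "- u" "u + x"] seminorm_le_power[OF assms] seminorm_le_power[OF V_minus[OF assms]]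
  by (simp add: add.assoc[symmetric])

lemma seminorm_zero: "seminorm 0 = 0"
  using seminorm_le_weight[of "[]"] seminorm_nonneg[of 0] by (simp add: decomposition_def total_def weight_def)

end

lemma continuous_on_group_add:
  "continuous_on UNIV (\<lambda>p::'g \<times> 'g. fst p + snd p :: 'g::topological_group_add)"
  unfolding continuous_on_def by (intro ballI tendsto_intros)

lemma neighbourhood_sum:
  fixes U :: "'g::topological_group_add set"
  assumes "open U" "0 \<in> U"
  obtains W where "open W" "0 \<in> W" "\<And>x y. x \<in> W \<Longrightarrow> y \<in> W \<Longrightarrow> x + y \<in> U"
proof -
  have "open ((\<lambda>p::'g \<times> 'g. fst p + snd p) -` U)"
    by (rule open_vimage[OF assms(1) continuous_on_group_add])
  then obtain A B where "open A" "open B" "(0, 0) \<in> A \<times> B" "A \<times> B \<subseteq> (\<lambda>p::'g \<times> 'g. fst p + snd p) -` U"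
    using assms(2) by (elim open_prod_elim[of _ "(0, 0)"]) auto
  then show ?thesis
    using that[of "A \<inter> B"] by (auto simp: subset_iff)
qed

lemma symmetric_neighbourhood_triple_sum:
  fixes U :: "'g::topological_group_add set"
  assumes U: "open U" "0 \<in> U"
  obtains W where "open W" "0 \<in> W" "\<And>x. x \<in> W \<Longrightarrow> - x \<in> W"
    "\<And>x y z. x \<in> W \<Longrightarrow> y \<in> W \<Longrightarrow> z \<in> W \<Longrightarrow> x + y + z \<in> U"
proof -
  obtain A where A: "open A" "0 \<in> A" "\<And>x y. x \<in> A \<Longrightarrow> y \<in> A \<Longrightarrow> x + y \<in> U"
    using neighbourhood_sum[OF U] by metis
  obtain B where B: "open B" "0 \<in> B" "\<And>x y. x \<in> B \<Longrightarrow> y \<in> B \<Longrightarrow> x + y \<in> A"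
    using neighbourhood_sum[OF A(1,2)] by metis
  let ?W = "(A \<inter> B) \<inter> uminus -` (A \<inter> B)"
  have "open (uminus -` (A \<inter> B))"
    by (rule open_vimage[OF open_Int[OF A(1) B(1)] continuous_on_uminus_group])
  then show ?thesis
    using A B that[of ?W] by auto
qed

lemma ex_neighbourhood_chain:
  fixes U :: "'g::topological_group_add set"
  assumes U: "open U" "0 \<in> U"
  obtains V where "neighbourhood_chain V" "V 1 \<subseteq> U"
proof -
  define P where "P W \<longleftrightarrow> open W \<and> 0 \<in> W \<and> (\<forall>x\<in>W. - x \<in> W)" for W :: "'g set"
  have step: "\<exists>W'. P W' \<and> (\<forall>x\<in>W'. \<forall>y\<in>W'. \<forall>z\<in>W'. x + y + z \<in> W)" if "open W" "0 \<in> W" for W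
    using symmetric_neighbourhood_triple_sum[OF that] unfolding P_def by metis
  have "\<exists>W. \<forall>n. P (W n) \<and>
      (\<forall>x\<in>W (Suc n). \<forall>y\<in>W (Suc n). \<forall>z\<in>W (Suc n). x + y + z \<in> W n \<inter> U)"
  proof (rule dependent_nat_choice)
    show "\<exists>x. P x" by (rule exI[of _ UNIV]) (simp add: P_def)
    show "\<exists>B. P B \<and> (\<forall>x\<in>B. \<forall>y\<in>B. \<forall>z\<in>B. x + y + z \<in> A \<inter> U)" if "P A" for A and n :: nat
      using step[of "A \<inter> U"] that U by (auto simp: P_def)
  qed
  then obtain W where W: "\<And>n. P (W n)"
      "\<And>n. \<forall>x\<in>W (Suc n). \<forall>y\<in>W (Suc n). \<forall>z\<in>W (Suc n). x + y + z \<in> W n \<inter> U"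
    by metis
  \<comment> \<open>\<open>W 0\<close> is discarded, as only the later sets are inside \<open>U\<close>\<close>
  define V where "V n = (case n of 0 \<Rightarrow> UNIV | Suc n \<Rightarrow> W (Suc n))" for n
  have "neighbourhood_chain V"
    using W by unfold_locales (auto simp: V_def P_def split: nat.splits)
  moreover have "V 1 \<subseteq> U"
  proof
    fix x assume "x \<in> V 1"
    then have "x \<in> W (Suc 0)" "0 \<in> W (Suc 0)" using W(1) by (auto simp: V_def P_def)
    then have "x + 0 + 0 \<in> U" using W(2) by blast
    then show "x \<in> U" by simp
  qed
  ultimately show ?thesis using that by blast
qed

section \<open>The algebra of right uniformly continuous functions on the group\<close>

interpretation left_translation: continuous_action euclidean "(+) :: 'g \<Rightarrow> 'g \<Rightarrow> 'g::topological_group_add"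
proof
  show "continuous_map (prod_topology euclidean euclidean) euclidean (\<lambda>(g, x). g + x :: 'g)"
    using continuous_on_group_add by (simp add: case_prod_unfold)
qed (auto simp: add.assoc)

lemma RUC_group_iff:
  fixes f :: "'g::topological_group_add \<Rightarrow> real"
  shows "f \<in> RUC_group \<longleftrightarrow> bounded (range f) \<and> uniform_limit UNIV (\<lambda>g x. f (g + x)) f (nhds 0)"
proof -
  have "continuous_on UNIV f" if ul: "uniform_limit UNIV (\<lambda>g x. f (g + x)) f (nhds 0)"
    unfolding continuous_on_def
  proof
    fix x :: 'g
    have "((\<lambda>y. y - x) \<longlongrightarrow> x - x) (at x)"
      by (intro tendsto_intros)
    then have "filterlim (\<lambda>y. y - x) (nhds 0) (at x)" by simp
    moreover have "((\<lambda>g. f (g + x)) \<longlongrightarrow> f x) (nhds 0)"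
      using tendsto_uniform_limitI[OF ul UNIV_I] .
    ultimately have "((\<lambda>y. f (y - x + x)) \<longlongrightarrow> f x) (at x)"
      by (rule filterlim_compose[rotated])
    then show "(f \<longlongrightarrow> f x) (at x)" by simp
  qed
  then show ?thesis
    by (auto simp: left_translation.RUC_iff)
qed

lemma RUC_group_bounded: "f \<in> RUC_group \<Longrightarrow> bounded (range f)"
  by (simp add: RUC_group_iff)

lemma RUC_group_const: "(\<lambda>x. c) \<in> RUC_group"
  by (simp add: RUC_group_iff uniform_limit_const)

lemma RUC_group_add: "f \<in> RUC_group \<Longrightarrow> k \<in> RUC_group \<Longrightarrow> (\<lambda>x. f x + k x) \<in> RUC_group"
  unfolding RUC_group_iff by (auto intro: bounded_plus_comp uniform_limit_add)

lemma RUC_group_mult: "f \<in> RUC_group \<Longrightarrow> k \<in> RUC_group \<Longrightarrow> (\<lambda>x. f x * k x) \<in> RUC_group"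
proof -
  assume fk: "f \<in> RUC_group" "k \<in> RUC_group"
  then obtain B C where "\<And>x. \<bar>f x\<bar> \<le> B" "\<And>x. \<bar>k x\<bar> \<le> C"
    by (auto simp: RUC_group_iff bounded_iff)
  then have "\<bar>f x * k x\<bar> \<le> B * C" for x
    by (simp add: abs_mult mult_mono' )
  then have "bounded (range (\<lambda>x. f x * k x))"
    by (auto simp: bounded_iff)
  with fk show ?thesis
    by (auto simp: RUC_group_iff intro: uniform_lim_mult)
qed

lemma RUC_group_inverse:
  assumes "f \<in> RUC_group" "e > 0" "\<And>x. e \<le> \<bar>f x\<bar>"
  shows "(\<lambda>x. inverse (f x)) \<in> RUC_group"
proof -
  have "\<bar>inverse (f x)\<bar> \<le> inverse e" for x
    using assms(2,3) by (simp add: le_imp_inverse_le)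
  then have "bounded (range (\<lambda>x. inverse (f x)))"
    by (auto simp: bounded_iff)
  moreover have "uniform_limit UNIV (\<lambda>g x. inverse (f (g + x))) (inverse \<circ> f) (nhds 0)"
    using assms by (intro uniform_lim_inverse[where b = e]) (auto simp: RUC_group_iff)
  ultimately show ?thesis
    by (simp add: RUC_group_iff o_def)
qed

lemma RUC_group_translate:
  assumes "f \<in> RUC_group"
  shows "(\<lambda>x. f (g + x)) \<in> RUC_group"
proof -
  have "((\<lambda>u. g + u - g) \<longlongrightarrow> g + 0 - g) (nhds 0)"
    by (intro tendsto_intros filterlim_ident)
  then have "filterlim (\<lambda>u. g + u - g) (nhds 0) (nhds 0)" by simp
  with assms have "uniform_limit UNIV (\<lambda>u x. f (g + u - g + x)) f (nhds 0)"
    unfolding RUC_group_iff using filterlim_compose by blast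
  from uniform_limit_compose'[OF this, of "\<lambda>x. g + x" UNIV]
  have "uniform_limit UNIV (\<lambda>u x. f (g + (u + x))) (\<lambda>x. f (g + x)) (nhds 0)"
    by (simp add: add.assoc[symmetric])
  moreover have "bounded (range (\<lambda>x. f (g + x)))"
    using RUC_group_bounded[OF assms] by (rule bounded_subset) auto
  ultimately show ?thesis
    by (simp add: RUC_group_iff)
qed

lemma translate_left_translation: "translate euclidean (+) g f = (\<lambda>x. f (g + x))"
  by (simp add: translate_def restrict_def)

text \<open>
  The function \<open>max 0 (1 - 2 * seminorm x)\<close> works. It changes by at most \<open>2 * (1 / 2) ^ n\<close> under
  addition of an element of \<open>V n\<close> on the left, because the seminorm is subadditive. It is nonzero
  only where the seminorm is below \<open>1 / 2\<close>, which implies membership in \<open>V 1\<close>.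
\<close>

lemma ex_RUC_group_bump:
  fixes U :: "'g::topological_group_add set"
  assumes U: "open U" "0 \<in> U"
  obtains f where "f \<in> RUC_group" "f 0 = 1" "\<And>x. x \<notin> U \<Longrightarrow> f x = 0"
proof -
  obtain V where "neighbourhood_chain V" and VU: "V 1 \<subseteq> U"
    using ex_neighbourhood_chain[OF U] by blast
  then interpret neighbourhood_chain V by simp
  define f where "f x = max 0 (1 - 2 * seminorm x)" for x
  have "\<bar>f x\<bar> \<le> 1" for x using seminorm_nonneg[of x] by (simp add: f_def)
  then have "bounded (range f)" by (auto simp: bounded_iff)
  moreover have "uniform_limit UNIV (\<lambda>g x. f (g + x)) f (nhds 0)"
  proof (rule uniform_limitI)
    fix e :: real assume "e > 0"
    then obtain n where n: "(1 / 2) ^ n < e / 2"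
      using real_arch_pow_inv[of "e / 2" "1 / 2"] by auto
    have "dist (f (u + x)) (f x) < e" if "u \<in> V n" for u x
      using seminorm_add_diff_le[OF that, of x] n unfolding f_def dist_real_def by linarith
    then show "\<forall>\<^sub>F u in nhds 0. \<forall>x\<in>UNIV. dist (f (u + x)) (f x) < e"
      unfolding eventually_nhds using V_open V_zero by blast
  qed
  moreover have "f x = 0" if "x \<notin> U" for x
  proof -
    have "\<not> seminorm x < 1 / 2"
    proof
      assume "seminorm x < 1 / 2"
      then obtain l where "decomposition l" "total l = x" "weight l < (1 / 2) ^ 1"
        unfolding seminorm_less_iff by auto
      with total_mem_if_weight_less[of l 1] VU that show False by blast
    qed
    then show ?thesis by (simp add: f_def)
  qed
  ultimately show ?thesis
    using that[of f] by (simp add: RUC_group_iff f_def seminorm_zero)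
qed

section \<open>The greatest ambit as a compact system\<close>

lemma closedin_Collect_Ball:
  assumes "\<And>i. i \<in> I \<Longrightarrow> closedin T {x \<in> topspace T. P i x}"
  shows "closedin T {x \<in> topspace T. \<forall>i\<in>I. P i x}"
proof -
  have "{x \<in> topspace T. \<forall>i\<in>I. P i x} = topspace T - (\<Union>i\<in>I. topspace T - {x \<in> topspace T. P i x})"
    by blast
  moreover have "openin T (\<Union>i\<in>I. topspace T - {x \<in> topspace T. P i x})"
    using assms by (intro openin_Union) (auto simp only: closedin_def)
  ultimately show ?thesis
    using closedin_diff[OF closedin_topspace] by simp
qed

lemma closedin_Collect_conj:
  assumes "closedin T {x \<in> topspace T. P x}" "closedin T {x \<in> topspace T. Q x}"
  shows "closedin T {x \<in> topspace T. P x \<and> Q x}"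
proof -
  have "{x \<in> topspace T. P x \<and> Q x} = {x \<in> topspace T. P x} \<inter> {x \<in> topspace T. Q x}"
    by blast
  then show ?thesis using closedin_Int[OF assms] by simp
qed

context
  fixes \<phi> :: "('g::topological_group_add \<Rightarrow> real) \<Rightarrow> real"
  assumes \<phi>: "\<phi> \<in> ambit_carrier"
begin

lemma ambit_add: "f \<in> RUC_group \<Longrightarrow> k \<in> RUC_group \<Longrightarrow> \<phi> (\<lambda>x. f x + k x) = \<phi> f + \<phi> k"
  and ambit_scale: "f \<in> RUC_group \<Longrightarrow> \<phi> (\<lambda>x. c * f x) = c * \<phi> f"
  and ambit_mult: "f \<in> RUC_group \<Longrightarrow> k \<in> RUC_group \<Longrightarrow> \<phi> (\<lambda>x. f x * k x) = \<phi> f * \<phi> k"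
  using \<phi> by (auto simp: ambit_carrier_def)

lemma ambit_one: "\<phi> (\<lambda>x. 1) = 1"
proof -
  obtain f where f: "f \<in> RUC_group" "\<phi> f \<noteq> 0"
    using \<phi> by (auto simp: ambit_carrier_def)
  then show ?thesis
    using ambit_mult[OF f(1) RUC_group_const[of 1]] by simp
qed

lemma ambit_const: "\<phi> (\<lambda>x. c) = c"
  using ambit_scale[OF RUC_group_const[of 1], of c] ambit_one by simp

text \<open>
  If \<open>\<phi> f\<close> were at a positive distance from the values of \<open>f\<close>, then \<open>f - \<phi> f\<close> would be invertible in the
  algebra although \<open>\<phi>\<close> maps it to \<open>0\<close>.
\<close>

lemma ambit_in_closure_range:
  assumes f: "f \<in> RUC_group"
  shows "\<phi> f \<in> closure (range f)"
proof (rule ccontr)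
  assume "\<phi> f \<notin> closure (range f)"
  then obtain e where e: "e > 0" "\<And>x. e \<le> \<bar>f x + - \<phi> f\<bar>"
    by (auto simp: closure_approachable dist_real_def not_less)
  let ?k = "\<lambda>x. f x + - \<phi> f"
  have k: "?k \<in> RUC_group"
    by (rule RUC_group_add[OF f RUC_group_const])
  have "(\<lambda>x. 1) = (\<lambda>x. ?k x * inverse (?k x))"
    using e by (intro ext) (metis abs_zero not_le right_inverse)
  then have "1 = \<phi> ?k * \<phi> (\<lambda>x. inverse (?k x))"
    using ambit_mult[OF k RUC_group_inverse[OF k e]] ambit_one by simp
  moreover have "\<phi> ?k = 0"
    using ambit_add[OF f RUC_group_const[of "- \<phi> f"]] ambit_const by simp
  ultimately show False by simp
qed

lemma ambit_dist_le:
  assumes f: "f \<in> RUC_group" and k: "k \<in> RUC_group" and le: "\<And>x. \<bar>f x - k x\<bar> \<le> B"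
  shows "\<bar>\<phi> f - \<phi> k\<bar> \<le> B"
proof -
  let ?d = "\<lambda>x. f x + (-1) * k x"
  have k': "(\<lambda>x. (-1) * k x) \<in> RUC_group"
    by (rule RUC_group_mult[OF RUC_group_const k])
  have "\<phi> ?d = \<phi> f - \<phi> k"
    using ambit_add[OF f k'] ambit_scale[OF k, of "-1"] by simp
  moreover have "closure (range ?d) \<subseteq> cball 0 B"
    by (rule closure_minimal) (use le in auto)
  ultimately show ?thesis
    using ambit_in_closure_range[OF RUC_group_add[OF f k']] by auto
qed

lemma ambit_action_apply: "f \<in> RUC_group \<Longrightarrow> ambit_action g \<phi> f = \<phi> (\<lambda>x. f (g + x))"
  by (simp add: ambit_action_def translate_left_translation)

lemma ambit_action_closed: "ambit_action g \<phi> \<in> ambit_carrier"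
proof -
  have "(\<lambda>x::'g. 1) \<in> RUC_group" by (rule RUC_group_const)
  moreover have "ambit_action g \<phi> (\<lambda>x. 1) = 1"
    using ambit_one by (simp add: ambit_action_apply RUC_group_const)
  moreover have "(\<lambda>x. c * f x) \<in> RUC_group" if "f \<in> RUC_group" for c and f :: "'g \<Rightarrow> real"
    by (rule RUC_group_mult[OF RUC_group_const that])
  ultimately show ?thesis
    unfolding ambit_carrier_def
    by (auto simp: ambit_action_apply RUC_group_add RUC_group_mult RUC_group_translate
        ambit_add ambit_scale ambit_mult intro!: bexI[of _ "\<lambda>x. 1"])
      (simp add: ambit_action_def)
qed

end

text \<open>
  The condition that a functional is not zero is not visibly closed, but for a multiplicative functional it
  says that the value at the constant \<open>1\<close> is \<open>1\<close>.
\<close>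

lemma ambit_carrier_eq:
  "ambit_carrier = {\<phi> \<in> topspace (product_topology (\<lambda>_. euclideanreal) RUC_group).
     (\<forall>f \<in> RUC_group. \<forall>k \<in> RUC_group. \<phi> (\<lambda>x::'g::topological_group_add. f x + k x) = \<phi> f + \<phi> k) \<and>
     (\<forall>c\<in>UNIV. \<forall>f \<in> RUC_group. \<phi> (\<lambda>x. c * f x) = c * \<phi> f) \<and>
     (\<forall>f \<in> RUC_group. \<forall>k \<in> RUC_group. \<phi> (\<lambda>x. f x * k x) = \<phi> f * \<phi> k) \<and>
     \<phi> (\<lambda>x. 1) = 1}" (is "_ = ?R")
proof
  show "ambit_carrier \<subseteq> ?R"
    using ambit_one by (auto simp: ambit_carrier_def PiE_UNIV_domain PiE_def)
  show "?R \<subseteq> ambit_carrier"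
  proof
    fix \<phi> :: "('g \<Rightarrow> real) \<Rightarrow> real" assume "\<phi> \<in> ?R"
    moreover from this have "\<phi> (\<lambda>x. 1) \<noteq> 0" by simp
    ultimately show "\<phi> \<in> ambit_carrier"
      using RUC_group_const[of 1] unfolding ambit_carrier_def topspace_product_topology PiE_def
      by blast
  qed
qed

lemma closedin_ambit_carrier:
  "closedin (product_topology (\<lambda>_. euclideanreal) RUC_group)
     (ambit_carrier :: (('g::topological_group_add \<Rightarrow> real) \<Rightarrow> real) set)"
  (is "closedin ?P _")
proof -
  have ev: "continuous_map ?P euclideanreal (\<lambda>\<phi>. \<phi> f)" if "f \<in> RUC_group" for f :: "'g \<Rightarrow> real"
    by (rule continuous_map_product_projection[OF that])
  have cl: "(\<lambda>x. c * f x) \<in> RUC_group" if "f \<in> RUC_group" for c and f :: "'g \<Rightarrow> real"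
    by (rule RUC_group_mult[OF RUC_group_const that])
  note eq = closedin_continuous_maps_eq[OF Hausdorff_space_euclidean]
  have 1: "closedin ?P {\<phi> \<in> topspace ?P. \<phi> (\<lambda>x. f x + k x) = \<phi> f + \<phi> k}"
    if "f \<in> RUC_group" "k \<in> RUC_group" for f k :: "'g \<Rightarrow> real"
    by (rule eq[OF ev[OF RUC_group_add[OF that]] continuous_map_add[OF ev[OF that(1)] ev[OF that(2)]]])
  have 2: "closedin ?P {\<phi> \<in> topspace ?P. \<phi> (\<lambda>x. c * f x) = c * \<phi> f}"
    if "f \<in> RUC_group" for c and f :: "'g \<Rightarrow> real"
    by (rule eq[OF ev[OF cl[OF that]] continuous_map_real_mult_left[OF ev[OF that]]])
  have 3: "closedin ?P {\<phi> \<in> topspace ?P. \<phi> (\<lambda>x. f x * k x) = \<phi> f * \<phi> k}"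
    if "f \<in> RUC_group" "k \<in> RUC_group" for f k :: "'g \<Rightarrow> real"
    by (rule eq[OF ev[OF RUC_group_mult[OF that]] continuous_map_real_mult[OF ev[OF that(1)] ev[OF that(2)]]])
  have 4: "closedin ?P {\<phi> \<in> topspace ?P. \<phi> (\<lambda>x::'g. 1) = 1}"
    by (rule eq[OF ev[OF RUC_group_const]]) simp
  have "closedin ?P {\<phi> \<in> topspace ?P. \<forall>f \<in> RUC_group. \<forall>k \<in> RUC_group. \<phi> (\<lambda>x::'g. f x + k x) = \<phi> f + \<phi> k}"
    by (rule closedin_Collect_Ball, rule closedin_Collect_Ball, rule 1)
  moreover have "closedin ?P {\<phi> \<in> topspace ?P. \<forall>c\<in>UNIV. \<forall>f \<in> RUC_group. \<phi> (\<lambda>x::'g. c * f x) = c * \<phi> f}"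
    by (rule closedin_Collect_Ball, rule closedin_Collect_Ball, rule 2)
  moreover have "closedin ?P {\<phi> \<in> topspace ?P. \<forall>f \<in> RUC_group. \<forall>k \<in> RUC_group. \<phi> (\<lambda>x::'g. f x * k x) = \<phi> f * \<phi> k}"
    by (rule closedin_Collect_Ball, rule closedin_Collect_Ball, rule 3)
  ultimately show ?thesis
    unfolding ambit_carrier_eq using 4
    by (rule closedin_Collect_conj[OF _ closedin_Collect_conj[OF _ closedin_Collect_conj]])
qed

lemma topspace_greatest_ambit: "topspace greatest_ambit = ambit_carrier"
  unfolding greatest_ambit_def topspace_subtopology
  using closedin_subset[OF closedin_ambit_carrier] by (rule Int_absorb1)

lemma compact_greatest_ambit:
  "compact_space (greatest_ambit :: (('g::topological_group_add \<Rightarrow> real) \<Rightarrow> real) topology)"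
proof -
  let ?P = "product_topology (\<lambda>_. euclideanreal) (RUC_group :: ('g \<Rightarrow> real) set)"
  have "compactin ?P (PiE RUC_group (\<lambda>f. closure (range f)))"
    using RUC_group_bounded by (auto simp: compactin_PiE)
  moreover have "ambit_carrier \<subseteq> PiE RUC_group (\<lambda>f. closure (range f))"
    using ambit_in_closure_range by (auto simp: PiE_def ambit_carrier_def)
  ultimately have "compactin ?P ambit_carrier"
    by (rule closed_compactin[OF _ _ closedin_ambit_carrier])
  then show ?thesis
    by (simp add: greatest_ambit_def compact_space_subtopology)
qed

lemma continuous_map_ambit_eval:
  "f \<in> RUC_group \<Longrightarrow> continuous_map greatest_ambit euclideanreal (\<lambda>\<phi>. \<phi> f)"
  unfolding greatest_ambit_def
  by (intro continuous_map_from_subtopology continuous_map_product_projection)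

lemma continuous_ambit_action_eval:
  fixes f :: "'g::topological_group_add \<Rightarrow> real"
  assumes f: "f \<in> RUC_group"
  shows "continuous_map (prod_topology euclidean greatest_ambit) euclideanreal
           (\<lambda>z. snd z (\<lambda>x. f (fst z + x)))"
proof (rule continuous_map_joint[where p = "\<lambda>g \<phi>. \<phi> (\<lambda>x. f (g + x))"])
  fix g :: 'g
  show "continuous_map greatest_ambit euclideanreal (\<lambda>\<phi>. \<phi> (\<lambda>x. f (g + x)))"
    by (rule continuous_map_ambit_eval[OF RUC_group_translate[OF f]])
  show "uniform_limit (topspace greatest_ambit) (\<lambda>g \<phi>. \<phi> (\<lambda>x. f (g + x)))
      (\<lambda>\<phi>. \<phi> (\<lambda>x. f (g + x))) (nhds g)"
  proof (rule uniform_limitI)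
    fix e :: real assume e: "e > 0"
    have "uniform_limit UNIV (\<lambda>h x. f (h + x)) (\<lambda>x. f (g + x)) (nhds g)"
      using left_translation.uniform_limit_translates[of f g] f by (simp add: RUC_group_iff)
    from uniform_limitD[OF this half_gt_zero[OF e]]
    show "\<forall>\<^sub>F h in nhds g. \<forall>\<phi>\<in>topspace greatest_ambit.
        dist (\<phi> (\<lambda>x. f (h + x))) (\<phi> (\<lambda>x. f (g + x))) < e"
    proof eventually_elim
      case (elim h)
      have "\<bar>\<phi> (\<lambda>x. f (h + x)) - \<phi> (\<lambda>x. f (g + x))\<bar> \<le> e / 2" if "\<phi> \<in> ambit_carrier" for \<phi>
        using elim by (intro ambit_dist_le[OF that] RUC_group_translate f)
          (auto simp: dist_real_def intro: less_imp_le)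
      then show ?case
        using e by (fastforce simp: topspace_greatest_ambit dist_real_def intro: le_less_trans[where y = "e / 2"])
    qed
  qed
qed

lemma compact_G_system_greatest_ambit:
  "compact_G_system greatest_ambit (ambit_action :: 'g::topological_group_add \<Rightarrow> _)"
proof -
  let ?A = "greatest_ambit :: (('g \<Rightarrow> real) \<Rightarrow> real) topology"
  let ?P = "product_topology (\<lambda>_. euclideanreal) (RUC_group :: ('g \<Rightarrow> real) set)"
  have haus: "Hausdorff_space ?A"
    unfolding greatest_ambit_def
    by (intro Hausdorff_space_subtopology) (auto simp: Hausdorff_space_product_topology)
  have "continuous_map (prod_topology euclidean ?A) ?P (\<lambda>z. ambit_action (fst z) (snd z))"
    unfolding continuous_map_componentwise
  proof (intro conjI ballI)
    fix f :: "'g \<Rightarrow> real" assume f: "f \<in> RUC_group"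
    show "continuous_map (prod_topology euclidean ?A) euclideanreal
        (\<lambda>z. ambit_action (fst z) (snd z) f)"
      by (rule continuous_map_eq[OF continuous_ambit_action_eval[OF f]])
        (auto simp: topspace_greatest_ambit ambit_action_apply f)
  qed (auto simp: ambit_action_def)
  then have cont: "continuous_map (prod_topology euclidean ?A) ?A (\<lambda>(g, \<phi>). ambit_action g \<phi>)"
    using ambit_action_closed topspace_greatest_ambit
    by (auto simp: greatest_ambit_def continuous_map_in_subtopology case_prod_unfold)
  have creg: "completely_regular_space ?A"
    by (rule compact_Hausdorff_imp_completely_regular_space[OF compact_greatest_ambit haus])
  have zero: "ambit_action 0 \<phi> = \<phi>" if "\<phi> \<in> ambit_carrier" for \<phi> :: "('g \<Rightarrow> real) \<Rightarrow> real"
  proof (rule extensionalityI)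
    show "\<phi> \<in> extensional RUC_group" using that by (simp add: ambit_carrier_def)
  qed (auto simp: ambit_action_apply[OF that], simp add: ambit_action_def)
  have add: "ambit_action (g + h) \<phi> = ambit_action g (ambit_action h \<phi>)"
    if "\<phi> \<in> ambit_carrier" for g h :: 'g and \<phi>
  proof (rule extensionalityI[where A = RUC_group])
    fix f :: "'g \<Rightarrow> real" assume f: "f \<in> RUC_group"
    show "ambit_action (g + h) \<phi> f = ambit_action g (ambit_action h \<phi>) f"
      using f by (simp add: ambit_action_apply that ambit_action_closed RUC_group_translate add.assoc)
  qed (auto simp: ambit_action_def)
  show ?thesis
    unfolding compact_G_system_def G_space_def
    using haus creg cont zero add compact_greatest_ambit
    by (simp add: topspace_greatest_ambit)
qed

lemma evaluation_in_ambit: "(\<lambda>f\<in>RUC_group. f x) \<in> ambit_carrier"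
proof -
  have "(\<lambda>x. c * f x) \<in> RUC_group" if "f \<in> RUC_group" for c and f :: "'a \<Rightarrow> real"
    by (rule RUC_group_mult[OF RUC_group_const that])
  then show ?thesis
    using RUC_group_const[of 1]
    by (auto simp: ambit_carrier_def RUC_group_add RUC_group_mult intro!: bexI[of _ "\<lambda>x. 1"])
qed

section \<open>The equivalence\<close>

text \<open>
  Take a bump function \<open>f\<close> with \<open>f 0 = 1\<close> that is supported in a small neighborhood, and a countable
  set \<open>C\<close> of group elements whose translates of \<open>f\<close> approximate all translates with error below
  \<open>1\<close>. If the translate by \<open>c\<close> approximates the one by \<open>h\<close>, comparing the two at \<open>- c\<close> shows that
  \<open>f (h - c) \<noteq> 0\<close>, so that \<open>h - c\<close> is in the neighborhood. This gives a covering by right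
  translates. To get left translates of \<open>U\<close>, the support is put in \<open>- U\<close> and \<open>h = - g\<close> is used.
\<close>

lemma uniformly_LindelofI_orbit_separable:
  assumes sep: "\<And>f. f \<in> RUC_group \<Longrightarrow>
      orbit_separable greatest_ambit (ambit_action :: 'g::topological_group_add \<Rightarrow> _) (\<lambda>\<phi>. \<phi> f)"
  shows "uniformly_Lindelof TYPE('g)"
  unfolding uniformly_Lindelof_def
proof (intro allI impI)
  fix U :: "'g set" assume U: "0 \<in> interior U"
  have "open (uminus -` interior U)"
    by (rule open_vimage[OF open_interior continuous_on_uminus_group])
  then obtain f where f: "f \<in> RUC_group" "f 0 = 1" "\<And>x. x \<notin> uminus -` interior U \<Longrightarrow> f x = 0"
    using ex_RUC_group_bump[of "uminus -` interior U"] U by auto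
  obtain C where C: "countable C" "\<And>g. \<exists>c\<in>C. \<forall>\<phi>\<in>ambit_carrier.
      \<bar>ambit_action g \<phi> f - ambit_action c \<phi> f\<bar> < 1"
    using sep[OF f(1)] unfolding orbit_separable_def topspace_greatest_ambit
    by (meson zero_less_one)
  have "\<exists>c\<in>uminus ` C. \<exists>u\<in>U. g = c + u" for g
  proof -
    obtain c where c: "c \<in> C" "\<forall>\<phi>\<in>ambit_carrier. \<bar>ambit_action (- g) \<phi> f - ambit_action c \<phi> f\<bar> < 1"
      using C(2) by blast
    \<comment> \<open>evaluation at the point \<open>- c\<close>, at which the translate of \<open>f\<close> by \<open>c\<close> takes the value \<open>f 0\<close>\<close>
    let ?\<phi> = "\<lambda>f\<in>RUC_group. f (- c)"
    have "ambit_action h ?\<phi> f = f (h + - c)" for h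
      using f(1) by (simp add: ambit_action_apply[OF evaluation_in_ambit] RUC_group_translate)
    then have "\<bar>f (- g + - c) - 1\<bar> < 1"
      using c(2) evaluation_in_ambit[of "- c"] f(2) by fastforce
    then have "- (- g + - c) \<in> interior U"
      using f(3) by fastforce
    then have "c + g \<in> U"
      using interior_subset by (auto simp: minus_add)
    then show ?thesis
      using c(1) by (intro bexI[of _ "- c"] bexI[of _ "c + g"]) (auto simp: add.assoc[symmetric])
  qed
  then have "UNIV = {c + u | c u. c \<in> uminus ` C \<and> u \<in> U}"
    by blast
  with C(1) show "\<exists>C. countable C \<and> UNIV = {c + u | c u. c \<in> C \<and> u \<in> U}"
    by (intro exI[of _ "uminus ` C"]) simp
qed

lemma orbit_separable_homeomorphic:
  assumes h: "homeomorphic_maps Y Z j k" and Y: "G_space Y b"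
    and sep: "orbit_separable Z (\<lambda>g z. j (b g (k z))) (F \<circ> k)"
  shows "orbit_separable Y b F"
proof -
  have kj: "\<And>x. x \<in> topspace Y \<Longrightarrow> k (j x) = x" and j: "\<And>x. x \<in> topspace Y \<Longrightarrow> j x \<in> topspace Z"
    using h by (auto simp: homeomorphic_maps_def continuous_map_def)
  have "\<bar>F (b g y) - F (b c y)\<bar> < e"
    if "\<forall>z\<in>topspace Z. \<bar>(F \<circ> k) (j (b g (k z))) - (F \<circ> k) (j (b c (k z)))\<bar> < e" "y \<in> topspace Y"
    for g c y e
    using bspec[OF that(1) j[OF that(2)]] that(2) kj G_space_closed[OF Y] by simp
  with sep show ?thesis
    unfolding orbit_separable_def by meson
qed

lemma orbit_separable_cong:
  assumes "orbit_separable X a F" "\<And>g x. x \<in> topspace X \<Longrightarrow> F (a g x) = F' (a g x)"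
  shows "orbit_separable X a F'"
  using assms unfolding orbit_separable_def by simp

theorem proposition4p2:
  fixes G :: "'g::{topological_group_add, t2_space} itself"
  shows
    "(uniformly_Lindelof G \<longleftrightarrow>
        m_approximable greatest_ambit (ambit_action :: 'g \<Rightarrow> _)) \<and>
     (uniformly_Lindelof G \<longleftrightarrow>
        (\<forall>(X :: ('x + (('g \<Rightarrow> real) \<Rightarrow> real)) topology) (a :: 'g \<Rightarrow> _).
           compact_G_system X a \<longrightarrow> m_approximable X a)) \<and>
     (uniformly_Lindelof G \<longleftrightarrow>
        (\<forall>(X :: ('x + (('g \<Rightarrow> real) \<Rightarrow> real)) topology) (a :: 'g \<Rightarrow> _).
           G_space X a \<longrightarrow> (\<forall>f \<in> RUC X a. metrizable_space (orbit_closure_system X a f))))"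
    (is "(_ \<longleftrightarrow> ?m2) \<and> (_ \<longleftrightarrow> ?m3) \<and> (_ \<longleftrightarrow> ?m4)")
proof -
  let ?A = "greatest_ambit :: (('g \<Rightarrow> real) \<Rightarrow> real) topology" and ?a = "ambit_action :: 'g \<Rightarrow> _"
  have G: "uniformly_Lindelof G \<longleftrightarrow> uniformly_Lindelof TYPE('g)"
    by (simp add: uniformly_Lindelof_def)
  note A = compact_G_system_greatest_ambit[where ?'g = 'g]
  then have AG: "G_space ?A ?a" by (simp add: compact_G_system_def)
  have 12: ?m2 if "uniformly_Lindelof TYPE('g)"
    by (rule uniformly_Lindelof_imp_m_approximable[OF that A])
  have 21: "uniformly_Lindelof TYPE('g)" if ?m2
    by (rule uniformly_LindelofI_orbit_separable)
      (rule m_approximable_imp_orbit_separable[OF A that continuous_map_ambit_eval])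
  \<comment> \<open>The greatest ambit is moved to the type over which the last two conditions quantify. Its
    compactness makes all continuous functions on the copy \<open>Z\<close> available in \<open>RUC\<close>.\<close>
  let ?j = "Inr :: _ \<Rightarrow> 'x + (('g \<Rightarrow> real) \<Rightarrow> real)"
  obtain Z k where jk: "homeomorphic_maps ?A Z ?j k"
    using homeomorphic_map_pushforward[of ?j ?A] by (auto simp: homeomorphic_map_maps)
  let ?b = "\<lambda>g z. ?j (?a g (k z))"
  have Z: "compact_G_system Z ?b"
    by (rule compact_G_system_transport[OF A jk])
  then interpret Z: continuous_action Z ?b
    by (simp add: compact_G_system_def G_space_imp_continuous_action)
  have ZF: "continuous_map Z euclideanreal ((\<lambda>\<phi>. \<phi> f) \<circ> k)" if "f \<in> RUC_group" for f
    using jk continuous_map_compose[OF _ continuous_map_ambit_eval[OF that]]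
    by (auto simp: homeomorphic_maps_def)
  have 31: "uniformly_Lindelof TYPE('g)" if ?m3
  proof (rule uniformly_LindelofI_orbit_separable)
    fix f :: "'g \<Rightarrow> real" assume f: "f \<in> RUC_group"
    have "m_approximable Z ?b" using that Z by blast
    from m_approximable_imp_orbit_separable[OF Z this ZF[OF f]]
    show "orbit_separable ?A ?a (\<lambda>\<phi>. \<phi> f)"
      by (rule orbit_separable_homeomorphic[OF jk AG])
  qed
  have 41: "uniformly_Lindelof TYPE('g)" if ?m4
  proof (rule uniformly_LindelofI_orbit_separable)
    fix f :: "'g \<Rightarrow> real" assume f: "f \<in> RUC_group"
    let ?F = "restrict ((\<lambda>\<phi>. \<phi> f) \<circ> k) (topspace Z)"
    have "?F \<in> RUC Z ?b"
      using Z ZF[OF f] by (intro Z.continuous_imp_restrict_RUC) (auto simp: compact_G_system_def)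
    then interpret F: RUC_orbit Z ?b ?F by unfold_locales
    have "metrizable_space F.X\<^sub>f"
      using that Z F.RUC by (auto simp: compact_G_system_def)
    from F.metrizable_orbit_closure_imp_orbit_separable[OF this]
    have "orbit_separable Z ?b ((\<lambda>\<phi>. \<phi> f) \<circ> k)"
      by (rule orbit_separable_cong) (use Z.action_closed in auto)
    then show "orbit_separable ?A ?a (\<lambda>\<phi>. \<phi> f)"
      by (rule orbit_separable_homeomorphic[OF jk AG])
  qed
  have 13: ?m3 if "uniformly_Lindelof TYPE('g)"
    using uniformly_Lindelof_imp_m_approximable[OF that] by blast
  have 14: ?m4 if "uniformly_Lindelof TYPE('g)"
  proof (intro allI impI ballI)
    fix X :: "('x + (('g \<Rightarrow> real) \<Rightarrow> real)) topology" and a :: "'g \<Rightarrow> _" and f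
    assume "G_space X a" "f \<in> RUC X a"
    then interpret RUC_orbit X a f
      by (intro RUC_orbit.intro G_space_imp_continuous_action RUC_orbit_axioms.intro)
    show "metrizable_space X\<^sub>f"
      by (rule uniformly_Lindelof_imp_metrizable_orbit_closure[OF that])
  qed
  show ?thesis
    unfolding G using 12 21 13 31 14 41 by blast
qed

end
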